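(* Let $k\geq 1$. Then for all natural numbers $d$, $m\geq d$, $l\geq k$ and $r$ there exists a natural number $n$ such that for every colouring $c:\mathrm{FIN}^{[d]}_k(n)\to\{1,2,\ldots,r\}$ there is a block sequence $B=(b_s)_{s=1}^m$ of length $m$ in $\mathrm{FIN}_l(n)$ such that the set $\left\langle \bigcup_{\vec{i}\in P_{k+1}^l}T_{\vec{i}}(B)\right\rangle_{P_k}^{[d]}$ is monochromatic for $c$ (i.e. $c$ is constant on it).
   Context: $\mathbb{N}=\{1,2,3,\ldots\}$. For $k\in\mathbb{N}$, $\mathrm{FIN}_k$ is the set of functions $p:\mathbb{N}\to\{0,1,\ldots,k\}$ whose support $\mathrm{supp}(p)=\{x:p(x)\neq 0\}$ is finite and which attain the value $k$. For $n\in\mathbb{N}$, $\mathrm{FIN}_k(n)=\{p\in\mathrm{FIN}_k:\mathrm{supp}(p)\subseteq\{1,\ldots,n\}\}$. A finite sequence $(b_s)_{s=1}^m$ of elements of $\mathrm{FIN}_k$ is a block sequence (of length $m$) if $\max\mathrm{supp}(b_s)<\min\mathrm{supp}(b_{s+1})$ for all $s<m$. $\mathrm{FIN}^{[d]}_k(n)$ is the set of block sequences of length $d$ in $\mathrm{FIN}_k(n)$. For an integer $i\geq 1$, $T_i$ is the operation on finitely supported functions $p:\mathbb{N}\to\{0,1,2,\ldots\}$ given by $T_i(p)(x)=p(x)$ if $p(x)<i$ and $T_i(p)(x)=p(x)-1$ if $p(x)\geq i$; $T_0$ is the identity. (So $T_i$ maps $\mathrm{FIN}_j$ into $\mathrm{FIN}_{j-1}$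 whenever $1\le i\le j$.) For $k\ge1$, $P_k=\prod_{j=1}^k\{0,1,\ldots,j\}$; for $\vec t=(t(1),\ldots,t(k))\in P_k$, $T_{\vec t}=T_{t(1)}\circ\cdots\circ T_{t(k)}$, and $\vec 0$ denotes the all-zero vector. For integers $1\le a\le b$, $P_a^b=\prod_{j=a}^b\{1,2,\ldots,j\}$ and for $\vec i=(i(a),\ldots,i(b))\in P_a^b$, $T_{\vec i}=T_{i(a)}\circ\cdots\circ T_{i(b)}$ (so it maps $\mathrm{FIN}_b$ into $\mathrm{FIN}_{a-1}$); $P_a^{a-1}$ consists of a single vector whose operation is the identity. For $l\ge k$ and a block sequence $B=(b_s)_{s=1}^m$ in $\mathrm{FIN}_l$, $\left\langle \bigcup_{\vec{i}\in P_{k+1}^l}T_{\vec{i}}(B)\right\rangle_{P_k}$ denotes the set of all functions $\sum_{s=1}^m T_{\vec t_s}(T_{\vec i_s}(b_s))$ where $\vec i_1,\ldots,\vec i_m\in P^l_{k+1}$, $\vec t_1,\ldots,\vec t_m\in P_k$, and $\vec t_s=\vec 0$ for at least one $s$; this is a subset of $\mathrm{FIN}_k$. The superscript $[d]$ denotes the set of block sequences of length $d$ all of whose terms lie in that set. *)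

theory Defs
  imports Complex_Main "HOL-Library.FuncSet"
begin

text \<open>
  The natural numbers of the source start at 1. A function on \<open>{1, 2, 3, \<dots>}\<close> is encoded as a
  function on \<^typ>\<open>nat\<close> with value 0 at 0; this is the condition \<open>supp p \<subseteq> {1..}\<close> below.
\<close>

definition supp :: "(nat \<Rightarrow> nat) \<Rightarrow> nat set" where
  "supp p = {x. p x \<noteq> 0}"

definition FIN :: "nat \<Rightarrow> (nat \<Rightarrow> nat) set" where
  "FIN k = {p. finite (supp p) \<and> supp p \<subseteq> {1..} \<and> range p \<subseteq> {0..k} \<and> (\<exists>x\<ge>1. p x = k)}"

definition FIN_upto :: "nat \<Rightarrow> nat \<Rightarrow> (nat \<Rightarrow> nat) set" where
  "FIN_upto k n = {p \<in> FIN k. supp p \<subseteq> {1..n}}"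

text \<open>A sequence \<open>(b\<^sub>s)\<close>, \<open>1 \<le> s \<le> m\<close>, is a list of length \<open>m\<close>; list positions start at 0.\<close>

definition block_sequence :: "(nat \<Rightarrow> nat) list \<Rightarrow> bool" where
  "block_sequence bs \<longleftrightarrow>
     (\<forall>s. Suc s < length bs \<longrightarrow> Max (supp (bs ! s)) < Min (supp (bs ! Suc s)))"

definition block_sequences :: "(nat \<Rightarrow> nat) set \<Rightarrow> nat \<Rightarrow> (nat \<Rightarrow> nat) list set" where
  "block_sequences X d = {bs. length bs = d \<and> set bs \<subseteq> X \<and> block_sequence bs}"

definition tetris :: "nat \<Rightarrow> (nat \<Rightarrow> nat) \<Rightarrow> nat \<Rightarrow> nat" where
  "tetris i p = (if i = 0 then p else (\<lambda>x. if p x < i then p x else p x - 1))"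

text \<open>
  \<open>tetris_comp a b t\<close> is \<open>T\<^bsub>t(a)\<^esub> \<circ> \<dots> \<circ> T\<^bsub>t(b)\<^esub>\<close>: the operation with index \<open>t b\<close> acts first.
  It is the identity if \<open>b < a\<close>.
\<close>

definition tetris_comp :: "nat \<Rightarrow> nat \<Rightarrow> (nat \<Rightarrow> nat) \<Rightarrow> (nat \<Rightarrow> nat) \<Rightarrow> nat \<Rightarrow> nat" where
  "tetris_comp a b t = foldr (\<lambda>j. tetris (t j)) [a..<Suc b]"

definition P_upto :: "nat \<Rightarrow> (nat \<Rightarrow> nat) set" where
  "P_upto k = (\<Pi>\<^sub>E j\<in>{1..k}. {0..j})"

definition zero_vec :: "nat \<Rightarrow> nat \<Rightarrow> nat" where
  "zero_vec k = (\<lambda>j\<in>{1..k}. 0)"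

text \<open>\<open>P_between a b\<close> is \<open>P\<^sub>a\<^sup>b\<close>; for \<open>b = a - 1\<close> it has exactly one element.\<close>

definition P_between :: "nat \<Rightarrow> nat \<Rightarrow> (nat \<Rightarrow> nat) set" where
  "P_between a b = (\<Pi>\<^sub>E j\<in>{a..b}. {1..j})"

text \<open>\<open>tetris_span k l B\<close> is \<open>\<langle>\<Union>\<^bsub>i \<in> P_between (k+1) l\<^esub> T\<^sub>i(B)\<rangle>\<^bsub>P_upto k\<^esub>\<close>.\<close>

definition tetris_span :: "nat \<Rightarrow> nat \<Rightarrow> (nat \<Rightarrow> nat) list \<Rightarrow> (nat \<Rightarrow> nat) set" where
  "tetris_span k l B =
     {(\<lambda>x. \<Sum>s<length B. tetris_comp 1 k (t s) (tetris_comp (k + 1) l (i s) (B ! s)) x) | i t.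
        (\<forall>s<length B. i s \<in> P_between (k + 1) l) \<and>
        (\<forall>s<length B. t s \<in> P_upto k) \<and>
        (\<exists>s<length B. t s = zero_vec k)}"

end

theory Submission
  imports Defs "HOL-Library.Ramsey"
begin

text \<open>
  Fix a block sequence \<open>B\<close> of height \<open>l\<close>; the elements of its span are the words \<open>\<Sum> f\<^sub>s \<circ> b\<^sub>s\<close> with
  nondecreasing 1-Lipschitz maps \<open>f\<^sub>s\<close>, and such a word has rank \<open>max f\<^sub>s(l)\<close>. The case \<open>d = 1\<close> is proved
  by induction on the rank \<open>k\<close>. If it holds for all smaller ranks, two fusion arguments give a
  sequence for which the colour of a word does not change when a part of rank \<open>i < k\<close> supported on an
  interval of blocks is replaced by any other part of rank \<open>i\<close> on that interval. Replacing blocks by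
  pyramids of blocks, the colour of a word depends only on its components of rank \<open>k\<close>. A product
  Ramsey theorem for the sets of jumps of the maps \<open>f\<^sub>s\<close> then makes it depend only on the set of
  positions of these components, and the finite unions theorem concludes. The case of general \<open>d\<close> follows
  by induction on \<open>d\<close> with one more fusion, which makes the colour independent of the last term.
\<close>

section \<open>Finite colourings\<close>

text \<open>The induction hypothesis concerns words of rank \<open>i\<close> on their own, whereas
  the argument must vary a part of rank \<open>i\<close> inside fixed surroundings. Once maps are
  frozen above the height of their blocks, a block has only finitely many possible contents
  (\<open>finite_lipc\<close>); so a block already chosen can be accounted for by the function that
  sends each of its contents to the resulting colour, and \<open>colour_product\<close> codes this
  function as one colour. Parts are interchangeable only if their ranks agree exactly. Erasing a low
  block therefore requires a neighbour of rank exactly \<open>k - 1\<close> that survives, and the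
  slopes of the pyramids supply it because a 1-Lipschitz map skips no value. Thinning consumes
  height, so \<open>gowers_at\<close> lets the height \<open>L\<close> of the initial sequence
  depend on the data. This costs nothing in the end: the initial blocks become \<open>L\<close>
  times the indicators of single points. For \<open>k = 1\<close> there is no smaller rank and a low
  block is zero, so only Ramsey's theorem and the unions theorem act.\<close>

lemma colour_product:
  assumes "finite J"
  obtains enc :: "('j \<Rightarrow> nat) \<Rightarrow> nat" and q :: nat
  where "\<And>\<phi>. (\<And>j. \<phi> j < r) \<Longrightarrow> enc \<phi> < q"
    and "\<And>\<phi> \<psi> j. (\<And>j. \<phi> j < r) \<Longrightarrow> (\<And>j. \<psi> j < r) \<Longrightarrow> enc \<phi> = enc \<psi> \<Longrightarrow> j \<in> J \<Longrightarrow> \<phi> j = \<psi> j"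
proof -
  let ?X = "J \<rightarrow>\<^sub>E {..<r}"
  have "finite ?X" by (simp add: assms finite_PiE)
  then obtain h where h: "bij_betw h ?X {..<card ?X}"
    using ex_bij_betw_finite_nat atLeast0LessThan by metis
  have mem: "restrict \<phi> J \<in> ?X" if "\<forall>j. \<phi> j < r" for \<phi> using that by auto
  show thesis
  proof (rule that[of "\<lambda>\<phi>. h (restrict \<phi> J)" "card ?X"])
    show "h (restrict \<phi> J) < card ?X" if "\<And>j. \<phi> j < r" for \<phi>
      using bij_betw_apply[OF h mem[of \<phi>]] that by simp
  next
    fix \<phi> \<psi> :: "'j \<Rightarrow> nat" and j
    assume a: "\<And>j. \<phi> j < r" "\<And>j. \<psi> j < r" "h (restrict \<phi> J) = h (restrict \<psi> J)" "j \<in> J"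
    have "restrict \<phi> J = restrict \<psi> J"
      using h mem[of \<phi>] mem[of \<psi>] a by (auto simp: bij_betw_def inj_on_def)
    then show "\<phi> j = \<psi> j" using a(4) by (metis restrict_apply')
  qed
qed

section \<open>Ramsey's theorem and its product form\<close>

lemma ramsey_colouring:
  "\<exists>N. \<forall>\<chi> :: nat set \<Rightarrow> nat. (\<forall>X. \<chi> X < r) \<longrightarrow>
     (\<exists>H \<subseteq> {..<N}. card H = q \<and> (\<exists>j. \<forall>X \<subseteq> H. card X = e \<longrightarrow> \<chi> X = j))"
proof -
  obtain N :: nat where N: "partn_lst {..<N} (replicate r q) e"
    using ramsey_full by blast
  show ?thesis
  proof (intro exI[of _ N] allI impI)
    fix \<chi> :: "nat set \<Rightarrow> nat" assume "\<forall>X. \<chi> X < r"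
    then have "\<chi> \<in> nsets {..<N} e \<rightarrow> {..<length (replicate r q)}" by auto
    then obtain i H where H: "i < r" "H \<in> nsets {..<N} (replicate r q ! i)" "\<chi> ` nsets H e \<subseteq> {i}"
      using N by (auto simp: partn_lst_def monochromatic_def)
    then have "H \<subseteq> {..<N}" "card H = q" by (auto simp: nsets_def)
    moreover have "\<chi> X = i" if "X \<subseteq> H" "card X = e" for X
    proof -
      have "finite X" using that \<open>H \<subseteq> {..<N}\<close> by (meson finite_lessThan finite_subset)
      then show ?thesis using that H(3) by (auto simp: nsets_def)
    qed
    ultimately show "\<exists>H \<subseteq> {..<N}. card H = q \<and> (\<exists>j. \<forall>X \<subseteq> H. card X = e \<longrightarrow> \<chi> X = j)" by blast
  qed
qed

text \<open>The first \<open>M\<close> coordinates are made homogeneous for the colour that records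
  the reaction to every possible last coordinate. One choice \<open>A0\<close> of them then
  represents all, and Ramsey's theorem treats the last coordinate. The ground set starts at 1
  because the sets will serve as jump sets of maps that vanish at 0.\<close>

lemma product_ramsey:
  "\<exists>L. \<forall>\<chi> :: (nat \<Rightarrow> nat set) \<Rightarrow> nat. (\<forall>A. \<chi> A < r) \<longrightarrow>
     (\<exists>H. (\<forall>s<M. H s \<subseteq> {1..L} \<and> card (H s) = l) \<and>
        (\<exists>j. \<forall>A. (\<forall>s<M. A s \<subseteq> H s \<and> card (A s) = k) \<longrightarrow> (\<forall>s\<ge>M. A s = {}) \<longrightarrow> \<chi> A = j))"
proof (induction M arbitrary: r)
  case 0
  show ?case
  proof (intro exI allI impI conjI)
    fix \<chi> :: "(nat \<Rightarrow> nat set) \<Rightarrow> nat" and A :: "nat \<Rightarrow> nat set"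
    assume "\<forall>s\<ge>0. A s = {}"
    then have "A = (\<lambda>_. {})" by auto
    then show "\<chi> A = \<chi> (\<lambda>_. {})" by simp
  qed auto
next
  case (Suc M)
  obtain N where N: "\<forall>\<chi> :: nat set \<Rightarrow> nat. (\<forall>X. \<chi> X < r) \<longrightarrow>
       (\<exists>H \<subseteq> {..<N}. card H = l \<and> (\<exists>j. \<forall>X \<subseteq> H. card X = k \<longrightarrow> \<chi> X = j))"
    using ramsey_colouring[of r l k] ..
  obtain enc :: "(nat set \<Rightarrow> nat) \<Rightarrow> nat" and q where
    enc: "\<And>\<phi>. (\<And>j. \<phi> j < r) \<Longrightarrow> enc \<phi> < q"
      "\<And>\<phi> \<psi> X. (\<And>j. \<phi> j < r) \<Longrightarrow> (\<And>j. \<psi> j < r) \<Longrightarrow> enc \<phi> = enc \<psi> \<Longrightarrow> X \<in> Pow {1..N} \<Longrightarrow> \<phi> X = \<psi> X"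
    by (rule colour_product[of "Pow {1..N}" r]) auto
  obtain L where L: "\<forall>\<chi> :: (nat \<Rightarrow> nat set) \<Rightarrow> nat. (\<forall>A. \<chi> A < q) \<longrightarrow>
     (\<exists>H. (\<forall>s<M. H s \<subseteq> {1..L} \<and> card (H s) = l) \<and>
        (\<exists>j. \<forall>A. (\<forall>s<M. A s \<subseteq> H s \<and> card (A s) = k) \<longrightarrow> (\<forall>s\<ge>M. A s = {}) \<longrightarrow> \<chi> A = j))"
    using Suc.IH[of q] ..
  show ?case
  proof (intro exI[of _ "max L N"] allI impI)
    fix \<chi> :: "(nat \<Rightarrow> nat set) \<Rightarrow> nat" assume \<chi>: "\<forall>A. \<chi> A < r"
    let ?\<chi>' = "\<lambda>A. enc (\<lambda>X. \<chi> (A(M := X)))"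
    have "\<forall>A. ?\<chi>' A < q" using enc(1) \<chi> by simp
    from L[THEN spec, THEN mp, OF this] obtain H j where
      H: "\<forall>s<M. H s \<subseteq> {1..L} \<and> card (H s) = l"
      and j: "\<And>A. (\<forall>s<M. A s \<subseteq> H s \<and> card (A s) = k) \<Longrightarrow> (\<forall>s\<ge>M. A s = {}) \<Longrightarrow> ?\<chi>' A = j"
      by blast
    show "\<exists>H. (\<forall>s<Suc M. H s \<subseteq> {1..max L N} \<and> card (H s) = l) \<and>
        (\<exists>j. \<forall>A. (\<forall>s<Suc M. A s \<subseteq> H s \<and> card (A s) = k) \<longrightarrow> (\<forall>s\<ge>Suc M. A s = {}) \<longrightarrow> \<chi> A = j)"
    \<comment> \<open>No choice \<open>A0\<close> exists when \<open>l < k\<close> and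
      \<open>0 < M\<close>, for instance. The homogeneity claim is then vacuous, and any
      \<open>K\<close> of the right size will do.\<close>
    proof (cases "\<exists>A0. (\<forall>s<M. A0 s \<subseteq> H s \<and> card (A0 s) = k) \<and> (\<forall>s\<ge>M. A0 s = {})")
      case True
      then obtain A0 where A0: "(\<forall>s<M. A0 s \<subseteq> H s \<and> card (A0 s) = k)" "\<forall>s\<ge>M. A0 s = {}" by blast
      obtain K i where K: "K \<subseteq> {..<N}" "card K = l"
        and i: "\<And>X. X \<subseteq> K \<Longrightarrow> card X = k \<Longrightarrow> \<chi> (A0(M := Suc ` X)) = i"
        using N[rule_format, of "\<lambda>X. \<chi> (A0(M := Suc ` X))"] \<chi> by blast
      show ?thesis
      proof (intro exI[of _ "H(M := Suc ` K)"] exI[of _ i] conjI allI impI)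
        fix s assume "s < Suc M"
        then show "(H(M := Suc ` K)) s \<subseteq> {1..max L N}" "card ((H(M := Suc ` K)) s) = l"
          using H K by (fastforce simp: less_Suc_eq card_image)+
      next
        fix A assume A: "\<forall>s<Suc M. A s \<subseteq> (H(M := Suc ` K)) s \<and> card (A s) = k" "\<forall>s\<ge>Suc M. A s = {}"
        have "?\<chi>' (A(M := {})) = j"
        proof (rule j)
          show "\<forall>s<M. (A(M := {})) s \<subseteq> H s \<and> card ((A(M := {})) s) = k"
            using A(1) by (metis fun_upd_other less_SucI less_irrefl)
          show "\<forall>s\<ge>M. (A(M := {})) s = {}" using A(2) by (metis fun_upd_apply le_neq_implies_less Suc_leI)
        qed
        also have "j = ?\<chi>' A0" using j[OF A0] by simp
        finally have eq: "?\<chi>' (A(M := {})) = ?\<chi>' A0" .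
        have AM: "A M \<subseteq> Suc ` K" "card (A M) = k" using A(1)[rule_format, of M] by simp_all
        have "A M \<in> Pow {1..N}" using AM(1) K(1) by fastforce
        from enc(2)[OF _ _ eq this] \<chi>
        have "\<chi> ((A(M := {}))(M := A M)) = \<chi> (A0(M := A M))" by blast
        moreover obtain X where X: "A M = Suc ` X" "X \<subseteq> K" using AM(1) by (meson subset_image_iff)
        ultimately show "\<chi> A = i" using i[OF X(2)] AM(2) by (simp add: card_image fun_upd_idem)
      qed
    next
      case False
      have "\<exists>K \<subseteq> {..<N}. card K = l" using N[rule_format, of "\<lambda>X. \<chi> (\<lambda>_. {})"] \<chi> by blast
      then obtain K where K: "K \<subseteq> {..<N}" "card K = l" by blast
      show ?thesis
      proof (intro exI[of _ "H(M := Suc ` K)"] exI[of _ 0] conjI allI impI)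
        fix s assume "s < Suc M"
        then show "(H(M := Suc ` K)) s \<subseteq> {1..max L N}" "card ((H(M := Suc ` K)) s) = l"
          using H K by (fastforce simp: less_Suc_eq card_image)+
      next
        fix A assume A: "\<forall>s<Suc M. A s \<subseteq> (H(M := Suc ` K)) s \<and> card (A s) = k" "\<forall>s\<ge>Suc M. A s = {}"
        have "\<forall>s<M. (A(M := {})) s \<subseteq> H s \<and> card ((A(M := {})) s) = k"
          using A(1) by (metis fun_upd_other less_SucI less_irrefl)
        moreover have "\<forall>s\<ge>M. (A(M := {})) s = {}" using A(2) by (metis fun_upd_apply le_neq_implies_less Suc_leI)
        ultimately show "\<chi> A = 0" using False by blast
      qed
    qed
  qed
qed

section \<open>The finite unions theorem\<close>

text \<open>A set version of Hilbert's cube lemma: cell 0 is a base present in every union, and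
  labels above \<open>D\<close> mean discarded points. A dimension is gained by appending a stretch
  of new points. Two of its \<open>Suc q\<close> possible lengths induce the same colouring of the
  subsets of the old points, and the points between these lengths form the new cell.\<close>

lemma affine_cube:
  "\<exists>Q. \<forall>\<chi> :: nat set \<Rightarrow> nat. (\<forall>X. \<chi> X < r) \<longrightarrow>
     (\<exists>\<tau> :: nat \<Rightarrow> nat. (\<forall>t\<le>D. \<exists>s<Q. \<tau> s = t) \<and>
        (\<exists>j. \<forall>T \<subseteq> {1..D}. \<chi> {s. s < Q \<and> \<tau> s \<in> insert 0 T} = j))"
proof (induction D arbitrary: r)
  case 0
  show ?case
    by (intro exI[of _ 1]) (auto intro!: exI[of _ "\<lambda>_. 0::nat"])
next
  case (Suc D)
  obtain Q where Q: "\<forall>\<chi> :: nat set \<Rightarrow> nat. (\<forall>X. \<chi> X < r) \<longrightarrow>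
     (\<exists>\<tau> :: nat \<Rightarrow> nat. (\<forall>t\<le>D. \<exists>s<Q. \<tau> s = t) \<and>
        (\<exists>j. \<forall>T \<subseteq> {1..D}. \<chi> {s. s < Q \<and> \<tau> s \<in> insert 0 T} = j))"
    using Suc.IH[of r] ..
  obtain enc :: "(nat set \<Rightarrow> nat) \<Rightarrow> nat" and q where
    enc: "\<And>\<phi>. (\<And>j. \<phi> j < r) \<Longrightarrow> enc \<phi> < q"
      "\<And>\<phi> \<psi> X. (\<And>j. \<phi> j < r) \<Longrightarrow> (\<And>j. \<psi> j < r) \<Longrightarrow> enc \<phi> = enc \<psi> \<Longrightarrow> X \<in> Pow {..<Q} \<Longrightarrow> \<phi> X = \<psi> X"
    by (rule colour_product[of "Pow {..<Q}" r]) auto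
  show ?case
  proof (intro exI[of _ "Q + Suc q"] allI impI)
    fix \<chi> :: "nat set \<Rightarrow> nat" assume \<chi>: "\<forall>X. \<chi> X < r"
    let ?e = "\<lambda>i. enc (\<lambda>X. \<chi> (X \<union> {Q..<Q + i}))"
    have "?e ` {0..q} \<subseteq> {..<q}" using enc(1) \<chi> by auto
    then have "card (?e ` {0..q}) \<le> q" by (metis card_lessThan card_mono finite_lessThan)
    then have "card (?e ` {0..q}) < card {0..q}" by simp
    then have "\<not> inj_on ?e {0..q}" using pigeonhole by blast
    then obtain a b where ab: "a < b" "b \<le> q" "?e a = ?e b"
      unfolding inj_on_def by (metis atLeastAtMost_iff linorder_neqE_nat)
    have ab_eq: "\<chi> (X \<union> {Q..<Q + a}) = \<chi> (X \<union> {Q..<Q + b})" if "X \<subseteq> {..<Q}" for X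
      using enc(2)[OF _ _ ab(3)] \<chi> that by blast
    obtain \<tau> j where \<tau>: "\<forall>t\<le>D. \<exists>s<Q. \<tau> s = t"
      and j: "\<And>T. T \<subseteq> {1..D} \<Longrightarrow> \<chi> ({s. s < Q \<and> \<tau> s \<in> insert 0 T} \<union> {Q..<Q + a}) = j"
      using Q[rule_format, of "\<lambda>X. \<chi> (X \<union> {Q..<Q + a})"] \<chi> by blast
    \<comment> \<open>The first \<open>a\<close> new points join the base and those from
      \<open>a\<close> to \<open>b\<close> form cell \<open>Suc D\<close>. That label is no longer
      free for discarded points, so these move to \<open>Suc (Suc D)\<close>.\<close>
    define \<sigma> where "\<sigma> s = (if s < Q then (if \<tau> s \<le> D then \<tau> s else Suc (Suc D)) else if s < Q + a then 0
       else if s < Q + b then Suc D else Suc (Suc D))" for s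
    show "\<exists>\<tau>. (\<forall>t\<le>Suc D. \<exists>s<Q + Suc q. \<tau> s = t) \<and>
        (\<exists>j. \<forall>T \<subseteq> {1..Suc D}. \<chi> {s. s < Q + Suc q \<and> \<tau> s \<in> insert 0 T} = j)"
    proof (rule exI[of _ \<sigma>], intro conjI exI[of "\<lambda>j. \<forall>T. _ T j" j] allI impI)
      fix t assume t: "t \<le> Suc D"
      show "\<exists>s<Q + Suc q. \<sigma> s = t"
      proof (cases "t = Suc D")
        case True
        then show ?thesis using ab by (intro exI[of _ "Q + a"]) (auto simp: \<sigma>_def)
      next
        case False
        then obtain s where "s < Q" "\<tau> s = t" using \<tau> t by (metis le_SucE)
        then show ?thesis using False t by (intro exI[of _ s]) (auto simp: \<sigma>_def)
      qed
    next
      fix T assume T: "T \<subseteq> {1..Suc D}"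
      let ?T = "T - {Suc D}"
      have T': "?T \<subseteq> {1..D}" using T by fastforce
      let ?S = "{s. s < Q \<and> \<tau> s \<in> insert 0 ?T}"
      have "{s. s < Q + Suc q \<and> \<sigma> s \<in> insert 0 T} =
          ?S \<union> (if Suc D \<in> T then {Q..<Q + b} else {Q..<Q + a})"
        using T ab by (auto simp: \<sigma>_def split: if_splits)
      moreover have "\<chi> (?S \<union> {Q..<Q + b}) = \<chi> (?S \<union> {Q..<Q + a})"
        by (rule ab_eq[symmetric]) auto
      ultimately show "\<chi> {s. s < Q + Suc q \<and> \<sigma> s \<in> insert 0 T} = j"
        using j[OF T'] by simp
    qed
  qed
qed

text \<open>The base of an affine cube becomes cell 0, and the induction hypothesis is applied to
  the other cells of the cube as atoms. Coarsening the atoms keeps every union with the base inside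
  the cube, so its colour remains fixed.\<close>

lemma unions_by_minimum:
  "\<exists>Q. \<forall>\<chi> :: nat set \<Rightarrow> nat. (\<forall>X. \<chi> X < r) \<longrightarrow>
     (\<exists>\<tau> :: nat \<Rightarrow> nat. (\<forall>t<m. \<exists>s<Q. \<tau> s = t) \<and>
        (\<exists>col. \<forall>t<m. \<forall>T \<subseteq> {t<..<m}. \<chi> {s. s < Q \<and> \<tau> s \<in> insert t T} = col t))"
proof (induction m)
  case 0
  show ?case by simp
next
  case (Suc m)
  then obtain D where D: "\<forall>\<chi> :: nat set \<Rightarrow> nat. (\<forall>X. \<chi> X < r) \<longrightarrow>
     (\<exists>\<tau> :: nat \<Rightarrow> nat. (\<forall>t<m. \<exists>s<D. \<tau> s = t) \<and>
        (\<exists>col. \<forall>t<m. \<forall>T \<subseteq> {t<..<m}. \<chi> {s. s < D \<and> \<tau> s \<in> insert t T} = col t))" ..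
  obtain Q where Q: "\<forall>\<chi> :: nat set \<Rightarrow> nat. (\<forall>X. \<chi> X < r) \<longrightarrow>
     (\<exists>\<tau> :: nat \<Rightarrow> nat. (\<forall>t\<le>D. \<exists>s<Q. \<tau> s = t) \<and>
        (\<exists>j. \<forall>T \<subseteq> {1..D}. \<chi> {s. s < Q \<and> \<tau> s \<in> insert 0 T} = j))"
    using affine_cube[of r D] ..
  show ?case
  proof (intro exI[of _ Q] allI impI)
    fix \<chi> :: "nat set \<Rightarrow> nat" assume \<chi>: "\<forall>X. \<chi> X < r"
    obtain \<tau> j where \<tau>: "\<And>t. t \<le> D \<Longrightarrow> \<exists>s<Q. \<tau> s = t"
      and j: "\<And>T. T \<subseteq> {1..D} \<Longrightarrow> \<chi> {s. s < Q \<and> \<tau> s \<in> insert 0 T} = j"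
      using Q[THEN spec, THEN mp, OF \<chi>] by blast
    have "\<forall>X. \<chi> {s. s < Q \<and> \<tau> s \<in> Suc ` X} < r" using \<chi> by simp
    from D[THEN spec, THEN mp, OF this]
    obtain \<rho> col where \<rho>: "\<And>t. t < m \<Longrightarrow> \<exists>s<D. \<rho> s = t"
      and col: "\<And>t T. t < m \<Longrightarrow> T \<subseteq> {t<..<m} \<Longrightarrow>
        \<chi> {s. s < Q \<and> \<tau> s \<in> Suc ` {s. s < D \<and> \<rho> s \<in> insert t T}} = col t"
      by blast
    define \<sigma> where "\<sigma> s = (case \<tau> s of 0 \<Rightarrow> 0 | Suc i \<Rightarrow> if i < D then Suc (\<rho> i) else Suc m)" for s
    show "\<exists>\<tau>. (\<forall>t<Suc m. \<exists>s<Q. \<tau> s = t) \<and>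
        (\<exists>col. \<forall>t<Suc m. \<forall>T \<subseteq> {t<..<Suc m}. \<chi> {s. s < Q \<and> \<tau> s \<in> insert t T} = col t)"
    proof (rule exI[of _ \<sigma>], intro conjI exI[of _ "case_nat j col"] allI impI)
      fix t assume t: "t < Suc m"
      show "\<exists>s<Q. \<sigma> s = t"
      proof (cases t)
        case 0
        then show ?thesis using \<tau>[of 0] by (auto simp: \<sigma>_def)
      next
        case (Suc t')
        then obtain i where i: "i < D" "\<rho> i = t'" using \<rho> t by auto
        then obtain s where "s < Q" "\<tau> s = Suc i" using \<tau>[of "Suc i"] by auto
        then show ?thesis using Suc i by (auto simp: \<sigma>_def intro!: exI[of _ s])
      qed
    next
      fix t T assume t: "t < Suc m" and T: "T \<subseteq> {t<..<Suc m}"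
      show "\<chi> {s. s < Q \<and> \<sigma> s \<in> insert t T} = case_nat j col t"
      proof (cases t)
        case 0
        have "{s. s < Q \<and> \<sigma> s \<in> insert t T} =
            {s. s < Q \<and> \<tau> s \<in> insert 0 (Suc ` {i. i < D \<and> Suc (\<rho> i) \<in> T})}"
          (is "?A = ?B")
        proof (rule set_eqI)
          fix x show "x \<in> ?A \<longleftrightarrow> x \<in> ?B"
            by (cases "\<tau> x") (use T 0 in \<open>auto simp: \<sigma>_def\<close>)
        qed
        moreover have "Suc ` {i. i < D \<and> Suc (\<rho> i) \<in> T} \<subseteq> {1..D}" by auto
        ultimately show ?thesis using j 0 by simp
      next
        case (Suc t')
        let ?T = "{u. Suc u \<in> T}"
        have "{s. s < Q \<and> \<sigma> s \<in> insert t T} =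
            {s. s < Q \<and> \<tau> s \<in> Suc ` {s. s < D \<and> \<rho> s \<in> insert t' ?T}}"
          (is "?A = ?B")
        proof (rule set_eqI)
          fix x show "x \<in> ?A \<longleftrightarrow> x \<in> ?B"
            by (cases "\<tau> x") (use T Suc t in \<open>auto simp: \<sigma>_def\<close>)
        qed
        moreover have "?T \<subseteq> {t'<..<m}" using T Suc by auto
        ultimately show ?thesis using col[of t' ?T] t Suc by simp
      qed
    qed
  qed
qed

lemma pigeonhole_large_fibre:
  assumes "\<And>x. x \<in> A \<Longrightarrow> f x < (r::nat)" "card A > r * m"
  obtains j where "m < card {x \<in> A. f x = j}"
proof (rule ccontr)
  assume "\<not> thesis"
  then have le: "card {x \<in> A. f x = j} \<le> m" for j using that by (meson not_le)
  have "A = (\<Union>j<r. {x \<in> A. f x = j})" using assms(1) by auto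
  then have "card A \<le> (\<Sum>j<r. card {x \<in> A. f x = j})"
    by (metis card_UN_le finite_lessThan)
  also have "\<dots> \<le> (\<Sum>j<r. m)" by (intro sum_mono le)
  finally show False using assms(2) by simp
qed

text \<open>Among \<open>r * m + 1\<close> cells, some \<open>m\<close> have the same colour
  attached to them as minimal labels. Any union of these cells has one of them as its least label,
  hence that common colour. The value \<open>m\<close> of the new labelling marks discarded
  points.\<close>

lemma disjoint_unions:
  "\<exists>Q. \<forall>\<chi> :: nat set \<Rightarrow> nat. (\<forall>X. \<chi> X < r) \<longrightarrow>
     (\<exists>\<tau> :: nat \<Rightarrow> nat. (\<forall>s. \<tau> s \<le> m) \<and> (\<forall>t<m. \<exists>s<Q. \<tau> s = t) \<and>
        (\<exists>j. \<forall>T \<subseteq> {..<m}. T \<noteq> {} \<longrightarrow> \<chi> {s. s < Q \<and> \<tau> s \<in> T} = j))"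
proof -
  define M where "M = Suc (r * m)"
  obtain Q where Q: "\<forall>\<chi> :: nat set \<Rightarrow> nat. (\<forall>X. \<chi> X < r) \<longrightarrow>
     (\<exists>\<tau> :: nat \<Rightarrow> nat. (\<forall>t<M. \<exists>s<Q. \<tau> s = t) \<and>
        (\<exists>col. \<forall>t<M. \<forall>T \<subseteq> {t<..<M}. \<chi> {s. s < Q \<and> \<tau> s \<in> insert t T} = col t))"
    using unions_by_minimum[of r M] ..
  show ?thesis
  proof (intro exI[of _ Q] allI impI)
    fix \<chi> :: "nat set \<Rightarrow> nat" assume \<chi>: "\<forall>X. \<chi> X < r"
    obtain \<tau> col where \<tau>: "\<And>t. t < M \<Longrightarrow> \<exists>s<Q. \<tau> s = t"
      and col: "\<And>t T. t < M \<Longrightarrow> T \<subseteq> {t<..<M} \<Longrightarrow> \<chi> {s. s < Q \<and> \<tau> s \<in> insert t T} = col t"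
      using Q[THEN spec, THEN mp, OF \<chi>] by blast
    have "col t < r" if "t \<in> {..<M}" for t using col[of t "{}"] \<chi> that by (metis empty_subsetI lessThan_iff)
    moreover have "card {..<M} > r * m" by (simp add: M_def)
    ultimately obtain j where "m < card {t \<in> {..<M}. col t = j}"
      by (rule pigeonhole_large_fibre)
    then obtain Z where Z: "Z \<subseteq> {t \<in> {..<M}. col t = j}" "card Z = m" "finite Z"
      by (meson less_imp_le obtain_subset_with_card_n)
    obtain h where h: "bij_betw h {..<m} Z"
      using ex_bij_betw_nat_finite[OF Z(3)] Z(2) by (auto simp: atLeast0LessThan)
    define \<sigma> where "\<sigma> s = (if \<tau> s \<in> Z then the_inv_into {..<m} h (\<tau> s) else m)" for s
    have inj: "inj_on h {..<m}" and im: "h ` {..<m} = Z" using h by (auto simp: bij_betw_def)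
    have \<sigma>_h: "\<sigma> s = t \<longleftrightarrow> \<tau> s = h t" if "t < m" for s t
    proof (cases "\<tau> s \<in> Z")
      case True
      then have "h (\<sigma> s) = \<tau> s" using f_the_inv_into_f[OF inj] im by (simp add: \<sigma>_def)
      moreover have "\<sigma> s < m" using the_inv_into_into[OF inj, of "\<tau> s" "{..<m}"] True im by (simp add: \<sigma>_def)
      ultimately show ?thesis using inj that by (metis inj_onD lessThan_iff)
    next
      case False
      then show ?thesis using that im by (auto simp: \<sigma>_def)
    qed
    show "\<exists>\<tau>. (\<forall>s. \<tau> s \<le> m) \<and> (\<forall>t<m. \<exists>s<Q. \<tau> s = t) \<and>
        (\<exists>j. \<forall>T \<subseteq> {..<m}. T \<noteq> {} \<longrightarrow> \<chi> {s. s < Q \<and> \<tau> s \<in> T} = j)"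
    proof (rule exI[of _ \<sigma>], intro conjI exI[of "\<lambda>j. \<forall>T. _ T j" j] allI impI)
      fix s show "\<sigma> s \<le> m"
        using the_inv_into_into[OF inj, of "\<tau> s" "{..<m}"] im by (auto simp: \<sigma>_def)
    next
      fix t assume "t < m"
      moreover have "h t < M" using \<open>t < m\<close> im Z(1) by blast
      ultimately show "\<exists>s<Q. \<sigma> s = t" using \<tau> \<sigma>_h by metis
    next
      fix T assume T: "T \<subseteq> {..<m}" "T \<noteq> {}"
      have sub: "h ` T \<subseteq> Z" using T im by blast
      have fin: "finite (h ` T)" using T finite_subset by blast
      define t where "t = Min (h ` T)"
      have t: "t \<in> h ` T" using Min_in[OF fin] T by (auto simp: t_def)
      have "{s. s < Q \<and> \<sigma> s \<in> T} = {s. s < Q \<and> \<tau> s \<in> h ` T}"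
        using \<sigma>_h T unfolding image_iff by (metis (no_types, lifting) lessThan_iff subsetD)
      also have "h ` T = insert t (h ` T - {t})" using t by blast
      finally have "{s. s < Q \<and> \<sigma> s \<in> T} = {s. s < Q \<and> \<tau> s \<in> insert t (h ` T - {t})}" .
      moreover have "h ` T - {t} \<subseteq> {t<..<M}"
      proof
        fix x assume "x \<in> h ` T - {t}"
        then have "t \<le> x" "x \<noteq> t" "x \<in> Z" using Min_le[OF fin] sub by (auto simp: t_def)
        then show "x \<in> {t<..<M}" using Z(1) by auto
      qed
      moreover have "t < M" "col t = j" using t sub Z(1) by auto
      ultimately show "\<chi> {s. s < Q \<and> \<sigma> s \<in> T} = j" using col[of t "h ` T - {t}"] by simp
    qed
  qed
qed

text \<open>Ramsey's theorem is applied once, to \<open>q\<close>-subsets coloured by the colours of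
  all their initial segments. In a homogeneous set of size \<open>q + q\<close>, a subset of the
  lower half is an initial segment of a \<open>q\<close>-set completed in the upper half, so only
  its size matters.\<close>

lemma colour_by_card:
  "\<exists>M. \<forall>\<chi> :: nat set \<Rightarrow> nat. (\<forall>X. \<chi> X < r) \<longrightarrow>
     (\<exists>H \<subseteq> {..<M}. card H = q \<and> (\<forall>X \<subseteq> H. \<forall>Y \<subseteq> H. card X = card Y \<longrightarrow> \<chi> X = \<chi> Y))"
proof -
  obtain enc :: "(nat \<Rightarrow> nat) \<Rightarrow> nat" and p where
    enc: "\<And>\<phi>. (\<And>j. \<phi> j < r) \<Longrightarrow> enc \<phi> < p"
      "\<And>\<phi> \<psi> e. (\<And>j. \<phi> j < r) \<Longrightarrow> (\<And>j. \<psi> j < r) \<Longrightarrow> enc \<phi> = enc \<psi> \<Longrightarrow> e \<in> {..q} \<Longrightarrow> \<phi> e = \<psi> e"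
    by (rule colour_product[of "{..q}" r]) auto
  obtain M where M: "\<forall>\<chi> :: nat set \<Rightarrow> nat. (\<forall>X. \<chi> X < p) \<longrightarrow>
       (\<exists>H \<subseteq> {..<M}. card H = q + q \<and> (\<exists>j. \<forall>X \<subseteq> H. card X = q \<longrightarrow> \<chi> X = j))"
    using ramsey_colouring[of p "q + q" q] ..
  define ini where "ini e X = {x \<in> X. card {y \<in> X. y < x} < e}" for e and X :: "nat set"
  show ?thesis
  proof (intro exI[of _ M] allI impI)
    fix \<chi> :: "nat set \<Rightarrow> nat" assume \<chi>: "\<forall>X. \<chi> X < r"
    have "\<forall>X. enc (\<lambda>e. \<chi> (ini e X)) < p" using enc(1) \<chi> by simp
    from M[THEN spec, THEN mp, OF this]
    obtain H j where H: "H \<subseteq> {..<M}" "card H = q + q"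
      and j: "\<And>X. X \<subseteq> H \<Longrightarrow> card X = q \<Longrightarrow> enc (\<lambda>e. \<chi> (ini e X)) = j"
      by blast
    have finH: "finite H" using H finite_subset by blast
    define H1 where "H1 = set (take q (sorted_list_of_set H))"
    define H2 where "H2 = set (drop q (sorted_list_of_set H))"
    have len: "length (sorted_list_of_set H) = q + q" using H by simp
    have H12: "H1 \<union> H2 = H"
      by (metis H1_def H2_def append_take_drop_id set_append finH set_sorted_list_of_set)
    have c1: "card H1 = q" "card H2 = q"
      using len by (auto simp: H1_def H2_def distinct_card)
    have less: "x < y" if "x \<in> H1" "y \<in> H2" for x y
    proof -
      have "strict_sorted (take q (sorted_list_of_set H) @ drop q (sorted_list_of_set H))" by simp
      then show ?thesis using that unfolding sorted_wrt_append H1_def H2_def by blast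
    qed
    have extend: "\<exists>X'. X' \<subseteq> H \<and> card X' = q \<and> ini (card X) X' = X" if X: "X \<subseteq> H1" for X
    proof -
      have finX: "finite X" using X finite_subset H1_def by blast
      have cX: "card X \<le> q" using X c1 by (metis H1_def List.finite_set card_mono)
      obtain Y where Y: "Y \<subseteq> H2" "card Y = q - card X" "finite Y"
        using obtain_subset_with_card_n[of "q - card X" H2] c1 by auto
      have disj: "X \<inter> Y = {}" using less X Y by blast
      have "ini (card X) (X \<union> Y) = X"
      proof
        show "X \<subseteq> ini (card X) (X \<union> Y)"
        proof
          fix x assume x: "x \<in> X"
          have "{y \<in> X \<union> Y. y < x} \<subseteq> X - {x}" using less X Y x by fastforce
          then have "card {y \<in> X \<union> Y. y < x} \<le> card (X - {x})" using finX by (simp add: card_mono)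
          also have "\<dots> < card X" using finX x by (rule card_Diff1_less)
          finally show "x \<in> ini (card X) (X \<union> Y)" using x by (simp add: ini_def)
        qed
        have "x \<notin> Y" if "x \<in> ini (card X) (X \<union> Y)" for x
        proof
          assume "x \<in> Y"
          then have "X \<subseteq> {y \<in> X \<union> Y. y < x}" using less X Y by blast
          then have "card X \<le> card {y \<in> X \<union> Y. y < x}" using finX Y by (simp add: card_mono)
          then show False using that by (simp add: ini_def)
        qed
        then show "ini (card X) (X \<union> Y) \<subseteq> X" by (auto simp: ini_def)
      qed
      moreover have "X \<union> Y \<subseteq> H" using X Y H12 by blast
      moreover have "card (X \<union> Y) = q" using disj finX Y cX by (simp add: card_Un_disjoint)
      ultimately show ?thesis by blast
    qed
    have "\<chi> X = \<chi> Y" if XY: "X \<subseteq> H1" "Y \<subseteq> H1" "card X = card Y" for X Y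
    proof -
      obtain X' where X': "X' \<subseteq> H" "card X' = q" "ini (card X) X' = X" using extend[OF XY(1)] by blast
      obtain Y' where Y': "Y' \<subseteq> H" "card Y' = q" "ini (card Y) Y' = Y" using extend[OF XY(2)] by blast
      have "card X \<le> q" using XY c1 by (metis H1_def List.finite_set card_mono)
      moreover have "enc (\<lambda>e. \<chi> (ini e X')) = enc (\<lambda>e. \<chi> (ini e Y'))"
        using j[OF X'(1,2)] j[OF Y'(1,2)] by simp
      ultimately have "\<chi> (ini (card X) X') = \<chi> (ini (card X) Y')"
        using enc(2)[of "\<lambda>e. \<chi> (ini e X')" "\<lambda>e. \<chi> (ini e Y')" "card X"] \<chi> by simp
      then show ?thesis using X' Y' XY by simp
    qed
    moreover have "H1 \<subseteq> {..<M}" using H H12 by blast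
    ultimately show "\<exists>H \<subseteq> {..<M}. card H = q \<and> (\<forall>X \<subseteq> H. \<forall>Y \<subseteq> H. card X = card Y \<longrightarrow> \<chi> X = \<chi> Y)"
      using c1(1) by blast
  qed
qed

text \<open>The cells of \<open>disjoint_unions\<close> may interleave, while refinements demand
  monotone labels. Where colours depend on cardinality only, the labels can be sorted: sorting
  preserves the size of every fibre, hence the colour of every union.\<close>

lemma finite_block_unions:
  "\<exists>M. \<forall>\<chi> :: nat set \<Rightarrow> nat. (\<forall>X. \<chi> X < r) \<longrightarrow>
     (\<exists>\<Sigma> \<subseteq> {..<M}. \<exists>\<tau> :: nat \<Rightarrow> nat. mono \<tau> \<and> (\<forall>t<m. \<exists>s\<in>\<Sigma>. \<tau> s = t) \<and>
        (\<exists>j. \<forall>T \<subseteq> {..<m}. T \<noteq> {} \<longrightarrow> \<chi> {s \<in> \<Sigma>. \<tau> s \<in> T} = j))"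
proof -
  obtain q where q: "\<forall>\<chi> :: nat set \<Rightarrow> nat. (\<forall>X. \<chi> X < r) \<longrightarrow>
     (\<exists>\<tau> :: nat \<Rightarrow> nat. (\<forall>s. \<tau> s \<le> m) \<and> (\<forall>t<m. \<exists>s<q. \<tau> s = t) \<and>
        (\<exists>j. \<forall>T \<subseteq> {..<m}. T \<noteq> {} \<longrightarrow> \<chi> {s. s < q \<and> \<tau> s \<in> T} = j))"
    using disjoint_unions[of r m] ..
  obtain M where M: "\<forall>\<chi> :: nat set \<Rightarrow> nat. (\<forall>X. \<chi> X < r) \<longrightarrow>
     (\<exists>H \<subseteq> {..<M}. card H = q \<and> (\<forall>X \<subseteq> H. \<forall>Y \<subseteq> H. card X = card Y \<longrightarrow> \<chi> X = \<chi> Y))"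
    using colour_by_card[of r q] ..
  show ?thesis
  proof (intro exI[of _ M] allI impI)
    fix \<chi> :: "nat set \<Rightarrow> nat" assume \<chi>: "\<forall>X. \<chi> X < r"
    obtain H where H: "H \<subseteq> {..<M}" "card H = q"
      and eq: "\<And>X Y. X \<subseteq> H \<Longrightarrow> Y \<subseteq> H \<Longrightarrow> card X = card Y \<Longrightarrow> \<chi> X = \<chi> Y"
      using M[THEN spec, THEN mp, OF \<chi>] by blast
    have finH: "finite H" using H finite_subset by blast
    define xs where "xs = sorted_list_of_set H"
    have xs: "length xs = q" "set xs = H" "strict_sorted xs" using H finH by (auto simp: xs_def)
    have inj: "inj_on ((!) xs) {..<q}" using xs by (metis inj_on_nth strict_sorted_iff lessThan_iff)
    have nth_H: "(!) xs ` X \<subseteq> H" if "X \<subseteq> {..<q}" for X using that xs by auto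
    obtain \<tau> j where \<tau>: "\<And>t. t < m \<Longrightarrow> \<exists>s<q. \<tau> s = t"
      and j: "\<And>T. T \<subseteq> {..<m} \<Longrightarrow> T \<noteq> {} \<Longrightarrow> \<chi> ((!) xs ` {s. s < q \<and> \<tau> s \<in> T}) = j"
      using q[rule_format, of "\<lambda>X. \<chi> ((!) xs ` X)"] \<chi> by blast
    define ys where "ys = sort (map \<tau> [0..<q])"
    have ys: "length ys = q" "sorted ys" by (auto simp: ys_def)
    have card_ys: "card {i. i < q \<and> ys ! i \<in> T} = card {s. s < q \<and> \<tau> s \<in> T}" for T
    proof -
      have "card {i. i < q \<and> ys ! i \<in> T} = length (filter (\<lambda>t. t \<in> T) ys)"
        using length_filter_conv_card[of "\<lambda>t. t \<in> T" ys] ys by simp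
      also have "\<dots> = length (filter (\<lambda>t. t \<in> T) (map \<tau> [0..<q]))"
        by (simp only: ys_def filter_sort length_sort)
      also have "\<dots> = card {s. s < q \<and> map \<tau> [0..<q] ! s \<in> T}"
        using length_filter_conv_card[of "\<lambda>t. t \<in> T" "map \<tau> [0..<q]"] by simp
      also have "{s. s < q \<and> map \<tau> [0..<q] ! s \<in> T} = {s. s < q \<and> \<tau> s \<in> T}" by auto
      finally show ?thesis .
    qed
    define idx where "idx x = card {y \<in> H. y < x}" for x
    have idx: "idx (xs ! i) = i" if "i < q" for i
    proof -
      have lt: "xs ! a < xs ! b \<longleftrightarrow> a < b" if "a < q" "b < q" for a b
        using that xs sorted_wrt_nth_less[of "(<)" xs]
        by (metis linorder_neqE_nat order_less_asym' less_irrefl)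
      have "{y \<in> H. y < xs ! i} = (!) xs ` {..<i}"
      proof
        show "{y \<in> H. y < xs ! i} \<subseteq> (!) xs ` {..<i}"
          using lt that xs by (fastforce simp flip: xs(2) simp: in_set_conv_nth)
        show "(!) xs ` {..<i} \<subseteq> {y \<in> H. y < xs ! i}"
          using lt that xs by (auto simp flip: xs(2))
      qed
      moreover have "inj_on ((!) xs) {..<i}" using inj that by (simp add: inj_on_subset)
      ultimately show ?thesis by (simp add: idx_def card_image)
    qed
    \<comment> \<open>Off \<open>H\<close> the label is read off from the position relative to
      \<open>H\<close>, and past the last position it is the largest label (0 if there is none).
      This makes \<open>\<rho>\<close> monotone on all numbers.\<close>
    define \<rho> where "\<rho> x = (if idx x < q then ys ! idx x else Max (insert 0 (set ys)))" for x
    have "mono \<rho>"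
    proof (rule monoI)
      fix x y :: nat assume "x \<le> y"
      then have "idx x \<le> idx y" unfolding idx_def using finH by (intro card_mono) auto
      then show "\<rho> x \<le> \<rho> y" using ys by (auto simp: \<rho>_def sorted_nth_mono)
    qed
    have fib: "{s \<in> H. \<rho> s \<in> T} = (!) xs ` {i. i < q \<and> ys ! i \<in> T}" for T
    proof -
      have "H = (!) xs ` {..<q}" using xs by (auto simp: set_conv_nth)
      moreover have "\<rho> (xs ! i) = ys ! i" if "i < q" for i using idx that by (simp add: \<rho>_def)
      ultimately show ?thesis by auto
    qed
    have card_fib: "card {s \<in> H. \<rho> s \<in> T} = card {s. s < q \<and> \<tau> s \<in> T}" for T
      unfolding fib card_ys[symmetric] by (intro card_image inj_on_subset[OF inj]) auto
    show "\<exists>\<Sigma> \<subseteq> {..<M}. \<exists>\<tau> :: nat \<Rightarrow> nat. mono \<tau> \<and> (\<forall>t<m. \<exists>s\<in>\<Sigma>. \<tau> s = t) \<and>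
        (\<exists>j. \<forall>T \<subseteq> {..<m}. T \<noteq> {} \<longrightarrow> \<chi> {s \<in> \<Sigma>. \<tau> s \<in> T} = j)"
    proof (intro exI[of _ H] exI[of _ \<rho>] exI[of _ j] conjI allI impI)
      fix t assume "t < m"
      then have "{s. s < q \<and> \<tau> s \<in> {t}} \<noteq> {}" using \<tau> by blast
      then have "card {s. s < q \<and> \<tau> s \<in> {t}} > 0" by (simp add: card_gt_0_iff)
      then have "{s \<in> H. \<rho> s \<in> {t}} \<noteq> {}" using card_fib[of "{t}"] by (metis card.empty less_irrefl)
      then show "\<exists>s\<in>H. \<rho> s = t" by blast
    next
      fix T assume "T \<subseteq> {..<m}" "T \<noteq> {}"
      then have "\<chi> ((!) xs ` {s. s < q \<and> \<tau> s \<in> T}) = j" by (rule j)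
      moreover have "\<chi> {s \<in> H. \<rho> s \<in> T} = \<chi> ((!) xs ` {s. s < q \<and> \<tau> s \<in> T})"
      proof (rule eq)
        have "inj_on ((!) xs) {s. s < q \<and> \<tau> s \<in> T}" by (rule inj_on_subset[OF inj]) auto
        then show "card {s \<in> H. \<rho> s \<in> T} = card ((!) xs ` {s. s < q \<and> \<tau> s \<in> T})"
          by (simp add: card_fib card_image)
      qed (auto intro: nth_H[THEN subsetD])
      ultimately show "\<chi> {s \<in> H. \<rho> s \<in> T} = j" by simp
    qed (fact H(1) \<open>mono \<rho>\<close>)+
  qed
qed

section \<open>Refinements\<close>

definition lip :: "(nat \<Rightarrow> nat) \<Rightarrow> bool" where
  "lip f \<longleftrightarrow> f 0 = 0 \<and> (\<forall>x. f x \<le> f (Suc x) \<and> f (Suc x) \<le> Suc (f x))"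

text \<open>Freezing a map above \<open>L\<close> is invisible on blocks of height at most
  \<open>L\<close>. It makes \<open>f L\<close> the maximum of \<open>f\<close> and leaves only
  finitely many maps.\<close>

definition lipc :: "nat \<Rightarrow> (nat \<Rightarrow> nat) set" where
  "lipc L = {f. lip f \<and> (\<forall>x\<ge>L. f x = f L)}"

text \<open>
  A vector \<open>F\<close> stands for the word obtained from a block sequence of height \<open>L\<close> and length \<open>n\<close> by
  composing its \<open>s\<close>-th block with \<open>F s\<close> and adding up. Compositions of tetris operations are exactly
  such nondecreasing 1-Lipschitz maps fixing 0.
\<close>

definition vecs :: "nat \<Rightarrow> nat \<Rightarrow> (nat \<Rightarrow> nat \<Rightarrow> nat) set" where
  "vecs L n = {F. (\<forall>s. F s \<in> lipc L) \<and> (\<forall>s\<ge>n. F s = (\<lambda>_. 0))}"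

definition top_on :: "nat set \<Rightarrow> nat \<Rightarrow> (nat \<Rightarrow> nat \<Rightarrow> nat) \<Rightarrow> nat \<Rightarrow> bool" where
  "top_on U L F i \<longleftrightarrow> (\<forall>s\<in>U. F s L \<le> i) \<and> (\<exists>s\<in>U. F s L = i)"

definition ranked :: "nat \<Rightarrow> nat \<Rightarrow> nat \<Rightarrow> (nat \<Rightarrow> nat \<Rightarrow> nat) set" where
  "ranked L n i = {F \<in> vecs L n. top_on UNIV L F i}"

text \<open>
  A pair \<open>(g, \<tau>)\<close> describes a coarser block sequence: its \<open>t\<close>-th block is the sum of the old blocks
  \<open>s\<close> with \<open>\<tau> s = t\<close>, each composed with \<open>g s\<close>. Old blocks are discarded by \<open>g s = 0\<close>.
\<close>

definition act :: "(nat \<Rightarrow> nat \<Rightarrow> nat) \<Rightarrow> (nat \<Rightarrow> nat) \<Rightarrow> (nat \<Rightarrow> nat \<Rightarrow> nat) \<Rightarrow> nat \<Rightarrow> nat \<Rightarrow> nat" where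
  "act g \<tau> F = (\<lambda>s. F (\<tau> s) \<circ> g s)"

text \<open>Monotone labels make the new blocks successive. Old blocks with labels from
  \<open>m\<close> on drop out by themselves, because vectors of length \<open>m\<close> vanish
  there.\<close>

definition refn :: "nat \<Rightarrow> nat \<Rightarrow> nat \<Rightarrow> nat \<Rightarrow> (nat \<Rightarrow> nat \<Rightarrow> nat) \<Rightarrow> (nat \<Rightarrow> nat) \<Rightarrow> bool" where
  "refn L n l m g \<tau> \<longleftrightarrow> g \<in> vecs L n \<and> (\<forall>s. g s L \<le> l) \<and> mono \<tau> \<and>
     (\<forall>t<m. \<exists>s<n. \<tau> s = t \<and> g s L = l)"

text \<open>The case \<open>d = 1\<close> at rank \<open>k\<close>, with the initial height
  \<open>L\<close> chosen along with the length \<open>n\<close>. Colourings are total, so they can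
  be composed with any construction without domain conditions.\<close>

definition gowers_at :: "nat \<Rightarrow> bool" where
  "gowers_at k \<longleftrightarrow> (\<forall>m l r. \<exists>n L. \<forall>C. (\<forall>F. C F < (r::nat)) \<longrightarrow>
     (\<exists>g \<tau>. refn L n l m g \<tau> \<and>
       (\<forall>F\<in>ranked l m k. \<forall>F'\<in>ranked l m k. C (act g \<tau> F) = C (act g \<tau> F'))))"

section \<open>Nondecreasing 1-Lipschitz maps\<close>

lemma lip_mono: "lip f \<Longrightarrow> x \<le> y \<Longrightarrow> f x \<le> f y"
  unfolding lip_def by (metis lift_Suc_mono_le)

lemma lip_le:
  assumes "lip f"
  shows "f x \<le> x"
proof (induction x)
  case 0
  show ?case using assms by (simp add: lip_def)
next
  case (Suc x)
  have "f (Suc x) \<le> Suc (f x)" using assms by (simp add: lip_def)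
  then show ?case using Suc by linarith
qed

lemma lip_comp: assumes "lip f" "lip g" shows "lip (f \<circ> g)"
proof -
  have "f (g x) \<le> f (g (Suc x)) \<and> f (g (Suc x)) \<le> Suc (f (g x))" for x
  proof -
    have "g x \<le> g (Suc x)" "g (Suc x) \<le> Suc (g x)" using assms(2) by (simp_all add: lip_def)
    then consider "g (Suc x) = g x" | "g (Suc x) = Suc (g x)" by linarith
    then show ?thesis using assms(1) by cases (simp_all add: lip_def)
  qed
  then show ?thesis using assms by (simp add: lip_def)
qed

text \<open>A discrete intermediate value theorem; it will locate a component of rank exactly
  \<open>k - 1\<close> on the slope of a pyramid.\<close>

lemma lip_surj:
  assumes "lip f"
  shows "i \<le> f x \<Longrightarrow> \<exists>y\<le>x. f y = i"
proof (induction x)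
  case 0
  then show ?case using assms by (auto simp: lip_def)
next
  case (Suc x)
  have *: "f (Suc x) \<le> Suc (f x)" using assms by (simp add: lip_def)
  show ?case
  proof (cases "i \<le> f x")
    case True
    then show ?thesis using Suc.IH le_SucI by blast
  next
    case False
    then have "f (Suc x) = i" using * Suc.prems by linarith
    then show ?thesis by blast
  qed
qed

lemma lip_zero: "lip (\<lambda>_. 0)" by (simp add: lip_def)

lemma lip_min: "lip (min l)"
  by (auto simp: lip_def)

lemma lipc_lip: "f \<in> lipc L \<Longrightarrow> lip f"
  by (simp add: lipc_def)

lemma lipc_const: "f \<in> lipc L \<Longrightarrow> L \<le> x \<Longrightarrow> f x = f L"
  unfolding lipc_def by blast

lemma lipcI: "lip f \<Longrightarrow> (\<And>x. L \<le> x \<Longrightarrow> f x = f L) \<Longrightarrow> f \<in> lipc L"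
  unfolding lipc_def by blast

lemma lipc_min: "f \<in> lipc l \<Longrightarrow> f \<circ> min l = f"
proof
  fix x assume "f \<in> lipc l"
  then show "(f \<circ> min l) x = f x"
    using lipc_const[of f l x] by (cases "l \<le> x") (simp_all add: min_def)
qed

lemma min_in_lipc: "l \<le> L \<Longrightarrow> min l \<in> lipc L"
  by (intro lipcI lip_min) (simp add: min_def)

lemma zero_in_lipc: "(\<lambda>_. 0) \<in> lipc L"
  by (intro lipcI lip_zero) simp

lemma lipc_mono: "L \<le> L' \<Longrightarrow> lipc L \<subseteq> lipc L'"
proof
  fix f assume f: "L \<le> L'" "f \<in> lipc L"
  show "f \<in> lipc L'"
  proof (rule lipcI)
    show "lip f" by (rule lipc_lip[OF f(2)])
    fix x assume "L' \<le> x"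
    then show "f x = f L'" using lipc_const[OF f(2), of x] lipc_const[OF f(2), of L'] f(1) by linarith
  qed
qed

lemma lipc_le: "f \<in> lipc L \<Longrightarrow> f x \<le> f L"
  using lip_mono[OF lipc_lip, of f L x L] lipc_const[of f L x] by (cases "x \<le> L") simp_all

lemma lipc_le_height: "f \<in> lipc L \<Longrightarrow> f x \<le> L"
  using lipc_le[of f L x] lip_le[OF lipc_lip, of f L L] by simp

lemma lipc_eq_zero: "f \<in> lipc L \<Longrightarrow> f L = 0 \<Longrightarrow> f = (\<lambda>_. 0)"
  using lipc_le[of f L] by fastforce

lemma lipc_comp: "f \<in> lipc l \<Longrightarrow> g \<in> lipc L \<Longrightarrow> f \<circ> g \<in> lipc L"
proof (rule lipcI)
  assume fg: "f \<in> lipc l" "g \<in> lipc L"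
  then show "lip (f \<circ> g)" by (intro lip_comp lipc_lip)
  fix x assume "L \<le> x"
  from lipc_const[OF fg(2) this] show "(f \<circ> g) x = (f \<circ> g) L" by simp
qed

lemma finite_lipc: "finite (lipc L)"
proof (rule finite_imageD)
  have "(\<lambda>f. restrict f {..L}) ` lipc L \<subseteq> {..L} \<rightarrow>\<^sub>E {..L}"
    using lipc_le_height by (auto simp: PiE_def Pi_def)
  then show "finite ((\<lambda>f. restrict f {..L}) ` lipc L)" by (rule finite_subset) (simp add: finite_PiE)
  show "inj_on (\<lambda>f. restrict f {..L}) (lipc L)"
  proof (rule inj_onI, rule ext)
    fix f g x assume fg: "f \<in> lipc L" "g \<in> lipc L" "restrict f {..L} = restrict g {..L}"
    then have eq: "f y = g y" if "y \<le> L" for y using that by (metis atMost_iff restrict_apply')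
    show "f x = g x"
    proof (cases "x \<le> L")
      case False
      then have "f x = f L" "g x = g L" using lipc_const[OF fg(1), of x] lipc_const[OF fg(2), of x] by simp_all
      then show ?thesis using eq by simp
    qed (rule eq)
  qed
qed

section \<open>Vectors and composition of refinements\<close>

lemma vecs_mono: "L \<le> L' \<Longrightarrow> n \<le> n' \<Longrightarrow> vecs L n \<subseteq> vecs L' n'"
  using lipc_mono[of L L'] by (auto simp: vecs_def)

lemma zero_in_vecs: "(\<lambda>_ _. 0) \<in> vecs L n"
  by (simp add: vecs_def zero_in_lipc)

lemma vecs_lipc: "F \<in> vecs L n \<Longrightarrow> F s \<in> lipc L"
  by (simp add: vecs_def)

lemma vecs_zero: "F \<in> vecs L n \<Longrightarrow> F s 0 = 0"
  using lipc_lip[OF vecs_lipc] by (simp add: lip_def)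

lemma refn_height: "refn L n l m g \<tau> \<Longrightarrow> L \<le> L' \<Longrightarrow> g s L' = g s L"
  by (rule lipc_const) (auto simp: refn_def vecs_def)

lemma vecs_eq_zero: "F \<in> vecs L n \<Longrightarrow> F s L = 0 \<Longrightarrow> F s = (\<lambda>_. 0)"
  by (rule lipc_eq_zero) (auto simp: vecs_def)

lemma refn_vecs: "refn L n l m g \<tau> \<Longrightarrow> g \<in> vecs L n" by (simp add: refn_def)

lemma act_vecs:
  assumes "g \<in> vecs L n" "F \<in> vecs l m"
  shows "act g \<tau> F \<in> vecs L n"
  using assms lipc_comp[OF vecs_lipc[OF assms(2)] vecs_lipc[OF assms(1)]] vecs_zero[OF assms(2)]
  by (simp add: vecs_def act_def comp_def)

text \<open>Rank survives a refinement because each new block contains an old one on which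
  \<open>g\<close> reaches the full height \<open>l\<close>. The condition \<open>1 \<le> i\<close>
  places a component of rank \<open>i\<close> among the first \<open>m\<close>, where such an old
  block exists.\<close>

lemma top_on_act:
  assumes r: "refn L n l m g \<tau>" and F: "F \<in> vecs l m" and t: "top_on U l F i" and i: "1 \<le> i"
  shows "top_on (\<tau> -` U) L (act g \<tau> F) i"
proof -
  have "act g \<tau> F s L \<le> i" if "\<tau> s \<in> U" for s
  proof -
    have "F (\<tau> s) (g s L) \<le> F (\<tau> s) l"
      using F by (intro lipc_le) (simp add: vecs_def)
    also have "\<dots> \<le> i" using t that by (simp add: top_on_def)
    finally show ?thesis by (simp add: act_def)
  qed
  moreover obtain u where u: "u \<in> U" "F u l = i" using t by (auto simp: top_on_def)
  have "u < m"
  proof (rule ccontr)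
    assume "\<not> u < m"
    then have "F u l = 0" using F by (simp add: vecs_def)
    then show False using u i by simp
  qed
  then obtain s where "\<tau> s = u" "g s L = l" using r by (auto simp: refn_def)
  then have "s \<in> \<tau> -` U" "act g \<tau> F s L = i" using u by (auto simp: act_def)
  ultimately show ?thesis by (auto simp: top_on_def)
qed

lemma act_ranked: "refn L n l m g \<tau> \<Longrightarrow> F \<in> ranked l m i \<Longrightarrow> 1 \<le> i \<Longrightarrow> act g \<tau> F \<in> ranked L n i"
  using top_on_act[of L n l m g \<tau> F UNIV i] act_vecs[OF refn_vecs, of L n l m g \<tau> F l m]
  by (simp add: ranked_def)

lemma act_act: "act g \<tau> (act h \<rho> F) = act (act g \<tau> h) (\<rho> \<circ> \<tau>) F"
  by (simp add: act_def comp_assoc)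

lemma refn_comp:
  assumes 1: "refn L n L1 n1 g \<tau>" and 2: "refn L1 n1 l m h \<rho>"
  shows "refn L n l m (act g \<tau> h) (\<rho> \<circ> \<tau>)"
  unfolding refn_def
proof (intro conjI allI impI)
  show "act g \<tau> h \<in> vecs L n" using 1 2 by (intro act_vecs) (auto simp: refn_def)
  show "act g \<tau> h s L \<le> l" for s
  proof -
    have "h (\<tau> s) (g s L) \<le> h (\<tau> s) L1" using 2 by (intro lipc_le) (simp add: refn_def vecs_def)
    also have "\<dots> \<le> l" using 2 by (simp add: refn_def)
    finally show ?thesis by (simp add: act_def)
  qed
  show "mono (\<rho> \<circ> \<tau>)" using 1 2 by (simp add: refn_def mono_def)
  show "\<exists>s<n. (\<rho> \<circ> \<tau>) s = t \<and> act g \<tau> h s L = l" if t: "t < m" for t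
  proof -
    obtain u where u: "u < n1" "\<rho> u = t" "h u L1 = l" using 2 t by (auto simp: refn_def)
    obtain s where "s < n" "\<tau> s = u" "g s L = L1" using 1 u by (auto simp: refn_def)
    then show ?thesis using u by (auto simp: act_def)
  qed
qed

lemma refn_weaken:
  assumes "refn L n l m g \<tau>" "L \<le> L'" "n \<le> n'"
  shows "refn L' n' l m g \<tau>"
proof -
  have g: "g s L' = g s L" for s using assms(1,2) by (rule refn_height)
  show ?thesis
    unfolding refn_def g
  proof (intro conjI allI impI)
    show "g \<in> vecs L' n'" using assms vecs_mono[of L L' n n'] refn_vecs by blast
    show "\<exists>s<n'. \<tau> s = t \<and> g s L = l" if "t < m" for t
    proof -
      obtain s where "s < n" "\<tau> s = t" "g s L = l" using assms(1) \<open>t < m\<close> by (auto simp: refn_def)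
      then show ?thesis using assms(3) by (intro exI[of _ s]) simp
    qed
  qed (use assms(1) in \<open>simp_all add: refn_def\<close>)
qed

lemma refn_id: "refn l m l m (\<lambda>s. if s < m then min l else (\<lambda>_. 0)) id"
  by (auto simp: refn_def vecs_def min_in_lipc zero_in_lipc mono_def)

text \<open>The ranks are treated from the largest down, each inside the refinement found so far.
  Homogeneity at a rank already treated persists, since refinements preserve rank.\<close>

lemma gowers_ranks_below:
  assumes "\<forall>i. 1 \<le> i \<longrightarrow> i < k \<longrightarrow> gowers_at i"
  shows "\<exists>n L. \<forall>C. (\<forall>F. C F < (r::nat)) \<longrightarrow> (\<exists>g \<tau>. refn L n l m g \<tau> \<and>
     (\<forall>i. 1 \<le> i \<longrightarrow> i < k \<longrightarrow> (\<forall>F\<in>ranked l m i. \<forall>F'\<in>ranked l m i. C (act g \<tau> F) = C (act g \<tau> F'))))"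
  using assms
proof (induction k)
  case 0
  then show ?case using refn_id by blast
next
  case (Suc k)
  have "\<forall>i. 1 \<le> i \<longrightarrow> i < k \<longrightarrow> gowers_at i" using Suc.prems by simp
  from Suc.IH[OF this] obtain n1 L1 where 1: "\<forall>C. (\<forall>F. C F < r) \<longrightarrow> (\<exists>g \<tau>. refn L1 n1 l m g \<tau> \<and>
     (\<forall>i. 1 \<le> i \<longrightarrow> i < k \<longrightarrow> (\<forall>F\<in>ranked l m i. \<forall>F'\<in>ranked l m i. C (act g \<tau> F) = C (act g \<tau> F'))))"
    by (elim exE)
  show ?case
  proof (cases "k = 0")
    case True
    then have "\<not> (1 \<le> i \<and> i < Suc k)" for i by simp
    then show ?thesis using refn_id by blast
  next
    case False
    then have "gowers_at k" using Suc.prems by simp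
    then obtain n L where 2: "\<forall>C. (\<forall>F. C F < r) \<longrightarrow> (\<exists>g \<tau>. refn L n L1 n1 g \<tau> \<and>
       (\<forall>F\<in>ranked L1 n1 k. \<forall>F'\<in>ranked L1 n1 k. C (act g \<tau> F) = C (act g \<tau> F')))"
      unfolding gowers_at_def by (elim allE[of _ n1] allE[of _ L1] allE[of _ r] exE)
    show ?thesis
    proof (rule exI[of _ n], rule exI[of _ L], intro allI impI)
      fix C :: "(nat \<Rightarrow> nat \<Rightarrow> nat) \<Rightarrow> nat" assume C: "\<forall>F. C F < r"
      from 2[THEN spec, THEN mp, OF C] obtain g \<tau> where g: "refn L n L1 n1 g \<tau>"
        and eq: "\<And>F F'. F \<in> ranked L1 n1 k \<Longrightarrow> F' \<in> ranked L1 n1 k \<Longrightarrow> C (act g \<tau> F) = C (act g \<tau> F')"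
        by blast
      have "\<forall>F. C (act g \<tau> F) < r" using C by simp
      from 1[THEN spec, THEN mp, OF this] obtain h \<rho> where h: "refn L1 n1 l m h \<rho>"
        and eq': "\<And>i F F'. 1 \<le> i \<Longrightarrow> i < k \<Longrightarrow> F \<in> ranked l m i \<Longrightarrow> F' \<in> ranked l m i \<Longrightarrow>
          C (act g \<tau> (act h \<rho> F)) = C (act g \<tau> (act h \<rho> F'))"
        by blast
      show "\<exists>g \<tau>. refn L n l m g \<tau> \<and> (\<forall>i. 1 \<le> i \<longrightarrow> i < Suc k \<longrightarrow>
          (\<forall>F\<in>ranked l m i. \<forall>F'\<in>ranked l m i. C (act g \<tau> F) = C (act g \<tau> F')))"
      proof (intro exI[of _ "act g \<tau> h"] exI[of _ "\<rho> \<circ> \<tau>"] conjI allI impI ballI)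
        show "refn L n l m (act g \<tau> h) (\<rho> \<circ> \<tau>)" using g h by (rule refn_comp)
        fix i F F' assume *: "1 \<le> i" "i < Suc k" "F \<in> ranked l m i" "F' \<in> ranked l m i"
        then show "C (act (act g \<tau> h) (\<rho> \<circ> \<tau>) F) = C (act (act g \<tau> h) (\<rho> \<circ> \<tau>) F')"
          using eq' eq act_ranked[OF h] unfolding act_act[symmetric] by (metis less_SucE)
      qed
    qed
  qed
qed

section \<open>Fusion\<close>

definition upset :: "nat set \<Rightarrow> bool" where
  "upset U \<longleftrightarrow> (\<forall>s\<in>U. \<forall>t\<ge>s. t \<in> U)"

text \<open>The transpose of a \<open>d\<close>-tuple of vectors: with the block as outer index, the
  content of one block is a single list out of finitely many, ready to be absorbed into a
  colour.\<close>

definition prefixes :: "nat \<Rightarrow> nat \<Rightarrow> nat \<Rightarrow> (nat \<Rightarrow> (nat \<Rightarrow> nat) list) set" where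
  "prefixes d l m = {P. (\<forall>s. set (P s) \<subseteq> lipc l \<and> length (P s) = d) \<and> (\<forall>s\<ge>m. P s = replicate d (\<lambda>_. 0))}"

definition act_list :: "(nat \<Rightarrow> nat \<Rightarrow> nat) \<Rightarrow> (nat \<Rightarrow> nat) \<Rightarrow> (nat \<Rightarrow> (nat \<Rightarrow> nat) list) \<Rightarrow> nat \<Rightarrow> (nat \<Rightarrow> nat) list" where
  "act_list g \<tau> P = (\<lambda>s. map (\<lambda>f. f \<circ> g s) (P (\<tau> s)))"

lemma act_list_act: "act_list g \<tau> (act_list h \<rho> P) = act_list (act g \<tau> h) (\<rho> \<circ> \<tau>) P"
  by (auto simp: act_list_def act_def comp_assoc)

lemma upset_vimage: "upset U \<Longrightarrow> mono \<tau> \<Longrightarrow> upset (\<tau> -` U)"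
  by (auto simp: upset_def mono_def)

text \<open>
  The blocks are chosen from left to right. The content of the blocks chosen so far has finitely many
  values, so it can be absorbed into the colour before the remaining blocks are refined.
\<close>

lemma fusion:
  assumes k: "\<forall>i. 1 \<le> i \<longrightarrow> i < k \<longrightarrow> gowers_at i"
  shows "\<exists>n L. \<forall>C. (\<forall>P v. C P v < (r::nat)) \<longrightarrow> (\<exists>g \<tau>. refn L n l m g \<tau> \<and>
     (\<forall>P v v' U i. 1 \<le> i \<longrightarrow> i < k \<longrightarrow> upset U \<longrightarrow> P \<in> prefixes d l m \<longrightarrow> v \<in> ranked l m i \<longrightarrow> v' \<in> ranked l m i \<longrightarrow>
        (\<forall>s\<in>U. P s = replicate d (\<lambda>_. 0)) \<longrightarrow> (\<forall>s. s \<notin> U \<longrightarrow> v s = (\<lambda>_. 0) \<and> v' s = (\<lambda>_. 0)) \<longrightarrow>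
        C (act_list g \<tau> P) (act g \<tau> v) = C (act_list g \<tau> P) (act g \<tau> v')))"
    (is "\<exists>n L. \<forall>C. (\<forall>P v. C P v < r) \<longrightarrow> (\<exists>g \<tau>. refn L n l m g \<tau> \<and> ?inv m C g \<tau>)")
proof (induction m arbitrary: r)
  case 0
  have "v \<notin> ranked l 0 i" if "1 \<le> i" for v i
    using that by (auto simp: ranked_def vecs_def top_on_def)
  then show ?case using refn_id by blast
next
  case (Suc m)
  let ?J = "{fs. set fs \<subseteq> lipc l \<and> length fs = d}"
  obtain enc :: "((nat \<Rightarrow> nat) list \<Rightarrow> nat) \<Rightarrow> nat" and q where
    enc: "\<And>\<phi>. (\<And>j. \<phi> j < r) \<Longrightarrow> enc \<phi> < q"
      "\<And>\<phi> \<psi> fs. (\<And>j. \<phi> j < r) \<Longrightarrow> (\<And>j. \<psi> j < r) \<Longrightarrow> enc \<phi> = enc \<psi> \<Longrightarrow> fs \<in> ?J \<Longrightarrow> \<phi> fs = \<psi> fs"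
    by (rule colour_product[of ?J r]) (auto intro: finite_lists_length_eq finite_lipc)
  obtain n' L' where IH: "\<forall>C. (\<forall>P v. C P v < q) \<longrightarrow> (\<exists>g \<tau>. refn L' n' l m g \<tau> \<and> ?inv m C g \<tau>)"
    using Suc.IH[of q] by (elim exE)
  \<comment> \<open>One block of height \<open>l\<close> is kept in front, followed by
    \<open>n'\<close> blocks of height \<open>L'\<close> for the induction hypothesis.\<close>
  let ?L = "max l L'" and ?n = "Suc n'"
  obtain n L where nL: "\<forall>C. (\<forall>F. C F < r) \<longrightarrow> (\<exists>g \<tau>. refn L n ?L ?n g \<tau> \<and>
     (\<forall>i. 1 \<le> i \<longrightarrow> i < k \<longrightarrow> (\<forall>F\<in>ranked ?L ?n i. \<forall>F'\<in>ranked ?L ?n i. C (act g \<tau> F) = C (act g \<tau> F'))))"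
    using gowers_ranks_below[OF k, of r ?L ?n] by (elim exE)
  let ?zero = "replicate d (\<lambda>_. 0) :: (nat \<Rightarrow> nat) list"
  show ?case
  proof (rule exI[of _ n], rule exI[of _ L], intro allI impI)
    fix C :: "(nat \<Rightarrow> (nat \<Rightarrow> nat) list) \<Rightarrow> (nat \<Rightarrow> nat \<Rightarrow> nat) \<Rightarrow> nat" assume C: "\<forall>P v. C P v < r"
    then have "\<forall>v. C (\<lambda>_. ?zero) v < r" by simp
    from nL[THEN spec, THEN mp, OF this] obtain g \<tau> where g: "refn L n ?L ?n g \<tau>"
      and eq: "\<And>i F F'. 1 \<le> i \<Longrightarrow> i < k \<Longrightarrow> F \<in> ranked ?L ?n i \<Longrightarrow> F' \<in> ranked ?L ?n i \<Longrightarrow>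
        C (\<lambda>_. ?zero) (act g \<tau> F) = C (\<lambda>_. ?zero) (act g \<tau> F')"
      by blast
    \<comment> \<open>The varying part is 0 on the first block, because \<open>D\<close> is
      consulted only when \<open>0 \<notin> U\<close>; the prefix may have any content
      \<open>fs\<close> there.\<close>
    define D where "D P v = enc (\<lambda>fs. C (act_list g \<tau> (case_nat fs P)) (act g \<tau> (case_nat (\<lambda>_. 0) v)))" for P v
    have "\<forall>P v. D P v < q" unfolding D_def using enc(1) C by simp
    from IH[THEN spec, THEN mp, OF this] obtain h \<rho> where h: "refn L' n' l m h \<rho>"
      and inv: "?inv m D h \<rho>"
      by blast
    define h' where "h' = case_nat (min l) h"
    define \<rho>' where "\<rho>' = case_nat 0 (Suc \<circ> \<rho>)"
    have h': "refn ?L ?n l (Suc m) h' \<rho>'"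
    proof -
      have hv: "h \<in> vecs ?L n'" using vecs_mono[of L' ?L n' n'] refn_vecs[OF h] by auto
      have hL: "h s ?L = h s L'" for s by (rule refn_height[OF h]) simp
      show ?thesis
        unfolding refn_def
      proof (intro conjI allI impI)
        show "h' \<in> vecs ?L ?n"
          using hv by (auto simp: vecs_def h'_def min_in_lipc Suc_le_eq split: nat.splits)
        show "h' s ?L \<le> l" for s
          using h by (cases s) (auto simp: h'_def hL refn_def)
        show "mono \<rho>'"
          using h by (auto simp: \<rho>'_def refn_def mono_def split: nat.splits)
        show "\<exists>s<?n. \<rho>' s = t \<and> h' s ?L = l" if t: "t < Suc m" for t
        proof (cases t)
          case 0
          then show ?thesis by (intro exI[of _ 0]) (simp add: \<rho>'_def h'_def)
        next
          case (Suc u)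
          then obtain s where "s < n'" "\<rho> s = u" "h s L' = l" using h t by (auto simp: refn_def)
          then show ?thesis using Suc hL by (intro exI[of _ "Suc s"]) (simp add: \<rho>'_def h'_def)
        qed
      qed
    qed
    show "\<exists>g \<tau>. refn L n l (Suc m) g \<tau> \<and> ?inv (Suc m) C g \<tau>"
    proof (intro exI[of _ "act g \<tau> h'"] exI[of _ "\<rho>' \<circ> \<tau>"] conjI allI impI)
      show "refn L n l (Suc m) (act g \<tau> h') (\<rho>' \<circ> \<tau>)" using g h' by (rule refn_comp)
      fix P :: "nat \<Rightarrow> (nat \<Rightarrow> nat) list" and v v' U i
      assume i: "1 \<le> i" "i < k" and U: "upset U" and P: "P \<in> prefixes d l (Suc m)"
        and v: "v \<in> ranked l (Suc m) i" "v' \<in> ranked l (Suc m) i"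
        and PU: "\<forall>s\<in>U. P s = ?zero" and vU: "\<forall>s. s \<notin> U \<longrightarrow> v s = (\<lambda>_. 0) \<and> v' s = (\<lambda>_. 0)"
      show "C (act_list (act g \<tau> h') (\<rho>' \<circ> \<tau>) P) (act (act g \<tau> h') (\<rho>' \<circ> \<tau>) v) =
        C (act_list (act g \<tau> h') (\<rho>' \<circ> \<tau>) P) (act (act g \<tau> h') (\<rho>' \<circ> \<tau>) v')"
      \<comment> \<open>If \<open>0 \<in> U\<close>, the upset is everything and the prefix is zero,
        the case for which \<open>g\<close> was chosen. Otherwise both varying parts live behind the
        first block.\<close>
      proof (cases "0 \<in> U")
        case True
        then have "P = (\<lambda>_. ?zero)" using U PU by (auto simp: upset_def)
        then have P0: "act_list (act g \<tau> h') (\<rho>' \<circ> \<tau>) P = (\<lambda>_. ?zero)"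
          by (simp add: act_list_def comp_def)
        show ?thesis
          unfolding P0 act_act[symmetric]
          by (intro eq[OF i] act_ranked[OF h' _ i(1)] v)
      next
        case False
        let ?U = "Suc -` U" and ?P = "\<lambda>s. P (Suc s)"
        have split: "act h' \<rho>' w = case_nat (\<lambda>_. 0) (act h \<rho> (\<lambda>s. w (Suc s)))" if "w 0 = (\<lambda>_. 0)" for w
        proof
          fix s show "act h' \<rho>' w s = case_nat (\<lambda>_. 0) (act h \<rho> (\<lambda>s. w (Suc s))) s"
            using that by (cases s) (simp_all add: act_def h'_def \<rho>'_def comp_def)
        qed
        have P_split: "act_list h' \<rho>' P = case_nat (P 0) (act_list h \<rho> ?P)"
        proof
          fix s
          have "map (\<lambda>f. f \<circ> min l) (P 0) = P 0"
            using P lipc_min by (intro map_idI) (auto simp: prefixes_def)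
          then show "act_list h' \<rho>' P s = case_nat (P 0) (act_list h \<rho> ?P) s"
            by (cases s) (simp_all add: act_list_def h'_def \<rho>'_def)
        qed
        have v0: "v 0 = (\<lambda>_. 0)" "v' 0 = (\<lambda>_. 0)" using vU False by auto
        have tail: "(\<lambda>s. w (Suc s)) \<in> ranked l m i" if w: "w \<in> ranked l (Suc m) i" "w 0 = (\<lambda>_. 0)" for w
        proof -
          obtain s where s: "w s l = i" using w(1) by (auto simp: ranked_def top_on_def)
          then obtain s' where "s = Suc s'" using w(2) i by (cases s) auto
          then show ?thesis using w(1) s by (auto simp: ranked_def vecs_def top_on_def)
        qed
        have "upset ?U" using U by (auto simp: upset_def)
        moreover have "?P \<in> prefixes d l m" using P by (simp add: prefixes_def)
        moreover have "\<forall>s\<in>?U. ?P s = ?zero" "\<forall>s. s \<notin> ?U \<longrightarrow> v (Suc s) = (\<lambda>_. 0) \<and> v' (Suc s) = (\<lambda>_. 0)"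
          using PU vU by auto
        ultimately have "D (act_list h \<rho> ?P) (act h \<rho> (\<lambda>s. v (Suc s))) = D (act_list h \<rho> ?P) (act h \<rho> (\<lambda>s. v' (Suc s)))"
          using inv i tail[OF v(1) v0(1)] tail[OF v(2) v0(2)] by blast
        from enc(2)[OF _ _ this[unfolded D_def], of "P 0"] C P
        have "C (act_list g \<tau> (case_nat (P 0) (act_list h \<rho> ?P))) (act g \<tau> (case_nat (\<lambda>_. 0) (act h \<rho> (\<lambda>s. v (Suc s))))) =
            C (act_list g \<tau> (case_nat (P 0) (act_list h \<rho> ?P))) (act g \<tau> (case_nat (\<lambda>_. 0) (act h \<rho> (\<lambda>s. v' (Suc s)))))"
          by (simp add: prefixes_def)
        then show ?thesis
          unfolding act_act[symmetric] act_list_act[symmetric] split[of v, OF v0(1)] split[of v', OF v0(2)] P_split .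
      qed
    qed
  qed
qed

text \<open>A vector is the sum of its restriction off \<open>U\<close>, read as a prefix with
  \<open>d = 1\<close>, and its restriction to \<open>U\<close>. At each position one summand is
  zero, so the decomposition is compatible with refinement.\<close>

lemma suffix_invariance:
  assumes k: "\<forall>i. 1 \<le> i \<longrightarrow> i < k \<longrightarrow> gowers_at i"
  shows "\<exists>n L. \<forall>C. (\<forall>F. C F < (r::nat)) \<longrightarrow> (\<exists>g \<tau>. refn L n l m g \<tau> \<and>
     (\<forall>F F' U i. 1 \<le> i \<longrightarrow> i < k \<longrightarrow> upset U \<longrightarrow> F \<in> vecs l m \<longrightarrow> F' \<in> vecs l m \<longrightarrow>
        top_on U l F i \<longrightarrow> top_on U l F' i \<longrightarrow> (\<forall>s. s \<notin> U \<longrightarrow> F s = F' s) \<longrightarrow>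
        C (act g \<tau> F) = C (act g \<tau> F')))"
proof -
  obtain n L where nL: "\<forall>C :: (nat \<Rightarrow> (nat \<Rightarrow> nat) list) \<Rightarrow> (nat \<Rightarrow> nat \<Rightarrow> nat) \<Rightarrow> nat. (\<forall>P v. C P v < r) \<longrightarrow> (\<exists>g \<tau>. refn L n l m g \<tau> \<and>
     (\<forall>P v v' U i. 1 \<le> i \<longrightarrow> i < k \<longrightarrow> upset U \<longrightarrow> P \<in> prefixes 1 l m \<longrightarrow> v \<in> ranked l m i \<longrightarrow> v' \<in> ranked l m i \<longrightarrow>
        (\<forall>s\<in>U. P s = replicate 1 (\<lambda>_. 0)) \<longrightarrow> (\<forall>s. s \<notin> U \<longrightarrow> v s = (\<lambda>_. 0) \<and> v' s = (\<lambda>_. 0)) \<longrightarrow>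
        C (act_list g \<tau> P) (act g \<tau> v) = C (act_list g \<tau> P) (act g \<tau> v')))"
    using fusion[OF k, of r l m 1] by (elim exE)
  show ?thesis
  proof (rule exI[of _ n], rule exI[of _ L], intro allI impI)
    fix C :: "(nat \<Rightarrow> nat \<Rightarrow> nat) \<Rightarrow> nat" assume C: "\<forall>F. C F < r"
    define D where "D P v = C (\<lambda>s x. (P s ! 0) x + v s x)" for P :: "nat \<Rightarrow> (nat \<Rightarrow> nat) list" and v
    have "\<forall>P v. D P v < r" using C by (simp add: D_def)
    from nL[THEN spec, THEN mp, OF this] obtain g \<tau> where g: "refn L n l m g \<tau>"
      and inv: "\<And>P v v' U i. 1 \<le> i \<Longrightarrow> i < k \<Longrightarrow> upset U \<Longrightarrow> P \<in> prefixes 1 l m \<Longrightarrow> v \<in> ranked l m i \<Longrightarrow> v' \<in> ranked l m i \<Longrightarrow>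
        (\<forall>s\<in>U. P s = replicate 1 (\<lambda>_. 0)) \<Longrightarrow> (\<forall>s. s \<notin> U \<longrightarrow> v s = (\<lambda>_. 0) \<and> v' s = (\<lambda>_. 0)) \<Longrightarrow>
        D (act_list g \<tau> P) (act g \<tau> v) = D (act_list g \<tau> P) (act g \<tau> v')"
      by blast
    show "\<exists>g \<tau>. refn L n l m g \<tau> \<and>
     (\<forall>F F' U i. 1 \<le> i \<longrightarrow> i < k \<longrightarrow> upset U \<longrightarrow> F \<in> vecs l m \<longrightarrow> F' \<in> vecs l m \<longrightarrow>
        top_on U l F i \<longrightarrow> top_on U l F' i \<longrightarrow> (\<forall>s. s \<notin> U \<longrightarrow> F s = F' s) \<longrightarrow>
        C (act g \<tau> F) = C (act g \<tau> F'))"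
    proof (intro exI[of _ g] exI[of _ \<tau>] conjI allI impI)
      show "refn L n l m g \<tau>" by (rule g)
      fix F F' U i assume i: "1 \<le> i" "i < k" and U: "upset U" and F: "F \<in> vecs l m" "F' \<in> vecs l m"
        and top: "top_on U l F i" "top_on U l F' i" and eq: "\<forall>s. s \<notin> U \<longrightarrow> F s = F' s"
      define P where "P s = [if s \<in> U then (\<lambda>_. 0) else F s]" for s
      define part where "part G s = (if s \<in> U then G s else (\<lambda>_. 0))" for G :: "nat \<Rightarrow> nat \<Rightarrow> nat" and s
      have part: "part G \<in> ranked l m i" if G: "G \<in> vecs l m" "top_on U l G i" for G
        using G by (auto simp: part_def ranked_def top_on_def vecs_def zero_in_lipc)
      have D: "D (act_list g \<tau> P) (act g \<tau> (part G)) = C (act g \<tau> G)" if "\<forall>s. s \<notin> U \<longrightarrow> F s = G s" for G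
        unfolding D_def using that by (intro arg_cong[of _ _ C] ext) (auto simp: act_list_def act_def P_def part_def)
      have "D (act_list g \<tau> P) (act g \<tau> (part F)) = D (act_list g \<tau> P) (act g \<tau> (part F'))"
      proof (rule inv[OF i U])
        show "P \<in> prefixes 1 l m" using F by (auto simp: prefixes_def P_def vecs_def zero_in_lipc)
      qed (use part F top in \<open>auto simp: P_def part_def\<close>)
      then show "C (act g \<tau> F) = C (act g \<tau> F')" using D[of F] D[of F'] eq by simp
    qed
  qed
qed

section \<open>From suffixes to intervals\<close>

definition convex_set :: "nat set \<Rightarrow> bool" where
  "convex_set U \<longleftrightarrow> (\<forall>a\<in>U. \<forall>b\<in>U. \<forall>c. a \<le> c \<longrightarrow> c \<le> b \<longrightarrow> c \<in> U)"

lemma top_on_nonzero_part: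
  assumes "top_on U l F i" "1 \<le> i" "F \<in> vecs l m" "U \<inter> {..<m} = V \<inter> {..<m}"
  shows "top_on V l F i"
proof -
  have le: "F s l \<le> i" if "s \<in> V" for s
  proof (cases "s < m")
    case True
    then show ?thesis using assms(1,4) that by (auto simp: top_on_def)
  next
    case False
    then show ?thesis using assms(3) by (simp add: vecs_def)
  qed
  obtain s where s: "s \<in> U" "F s l = i" using assms(1) by (auto simp: top_on_def)
  then have "s < m" using assms(2,3) by (cases "s < m") (auto simp: vecs_def)
  then show ?thesis using s le assms(4) by (auto simp: top_on_def)
qed

text \<open>
  Now the blocks are chosen from right to left, which makes the content of later blocks part of the colour.
\<close>

lemma interval_invariance:
  assumes k: "\<forall>i. 1 \<le> i \<longrightarrow> i < k \<longrightarrow> gowers_at i"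
  shows "\<exists>n L. \<forall>C. (\<forall>F. C F < (r::nat)) \<longrightarrow> (\<exists>g \<tau>. refn L n l m g \<tau> \<and>
     (\<forall>F F' U i. 1 \<le> i \<longrightarrow> i < k \<longrightarrow> convex_set U \<longrightarrow> F \<in> vecs l m \<longrightarrow> F' \<in> vecs l m \<longrightarrow>
        top_on U l F i \<longrightarrow> top_on U l F' i \<longrightarrow> (\<forall>s. s \<notin> U \<longrightarrow> F s = F' s) \<longrightarrow>
        C (act g \<tau> F) = C (act g \<tau> F')))"
    (is "\<exists>n L. \<forall>C. (\<forall>F. C F < r) \<longrightarrow> (\<exists>g \<tau>. refn L n l m g \<tau> \<and> ?inv m C g \<tau>)")
proof (induction m arbitrary: r)
  case 0
  have "\<not> top_on U l F i" if "F \<in> vecs l 0" "1 \<le> i" for U F i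
    using that by (auto simp: top_on_def vecs_def)
  then show ?case using refn_id by blast
next
  case (Suc m)
  obtain enc :: "((nat \<Rightarrow> nat) \<Rightarrow> nat) \<Rightarrow> nat" and q where
    enc: "\<And>\<phi>. (\<And>j. \<phi> j < r) \<Longrightarrow> enc \<phi> < q"
      "\<And>\<phi> \<psi> f. (\<And>j. \<phi> j < r) \<Longrightarrow> (\<And>j. \<psi> j < r) \<Longrightarrow> enc \<phi> = enc \<psi> \<Longrightarrow> f \<in> lipc l \<Longrightarrow> \<phi> f = \<psi> f"
    by (rule colour_product[of "lipc l" r]) (auto intro: finite_lipc)
  obtain n' L' where IH: "\<forall>C. (\<forall>F. C F < q) \<longrightarrow> (\<exists>g \<tau>. refn L' n' l m g \<tau> \<and> ?inv m C g \<tau>)"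
    using Suc.IH[of q] by (elim exE)
  let ?L = "max l L'" and ?n = "Suc n'"
  obtain n L where nL: "\<forall>C. (\<forall>F. C F < r) \<longrightarrow> (\<exists>g \<tau>. refn L n ?L ?n g \<tau> \<and>
     (\<forall>F F' U i. 1 \<le> i \<longrightarrow> i < k \<longrightarrow> upset U \<longrightarrow> F \<in> vecs ?L ?n \<longrightarrow> F' \<in> vecs ?L ?n \<longrightarrow>
        top_on U ?L F i \<longrightarrow> top_on U ?L F' i \<longrightarrow> (\<forall>s. s \<notin> U \<longrightarrow> F s = F' s) \<longrightarrow>
        C (act g \<tau> F) = C (act g \<tau> F')))"
    using suffix_invariance[OF k, of r ?L ?n] by (elim exE)
  show ?case
  proof (rule exI[of _ n], rule exI[of _ L], intro allI impI)
    fix C :: "(nat \<Rightarrow> nat \<Rightarrow> nat) \<Rightarrow> nat" assume C: "\<forall>F. C F < r"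
    from nL[THEN spec, THEN mp, OF C] obtain g \<tau> where g: "refn L n ?L ?n g \<tau>"
      and suf: "\<And>F F' U i. 1 \<le> i \<Longrightarrow> i < k \<Longrightarrow> upset U \<Longrightarrow> F \<in> vecs ?L ?n \<Longrightarrow> F' \<in> vecs ?L ?n \<Longrightarrow>
        top_on U ?L F i \<Longrightarrow> top_on U ?L F' i \<Longrightarrow> (\<forall>s. s \<notin> U \<longrightarrow> F s = F' s) \<Longrightarrow>
        C (act g \<tau> F) = C (act g \<tau> F')"
      by blast
    define D where "D F = enc (\<lambda>f. C (act g \<tau> (F(n' := f))))" for F
    have "\<forall>F. D F < q" unfolding D_def using enc(1) C by simp
    from IH[THEN spec, THEN mp, OF this] obtain h \<rho> where h: "refn L' n' l m h \<rho>"
      and inv: "?inv m D h \<rho>"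
      by blast
    \<comment> \<open>Label \<open>m\<close> now belongs to the reserved last block. Earlier blocks
      that \<open>\<rho>\<close> sends to \<open>m\<close> or beyond are therefore silenced, with
      their labels capped at \<open>m\<close> to keep \<open>\<rho>'\<close> monotone.\<close>
    define h' where "h' s = (if s < n' \<and> \<rho> s < m then h s else if s = n' then min l else (\<lambda>_. 0))" for s
    define \<rho>' where "\<rho>' s = (if s < n' then min (\<rho> s) m else m)" for s
    have h': "refn ?L ?n l (Suc m) h' \<rho>'"
    proof -
      have hv: "h \<in> vecs ?L n'" using vecs_mono[of L' ?L n' n'] refn_vecs[OF h] by auto
      have hL: "h s ?L = h s L'" for s by (rule refn_height[OF h]) simp
      show ?thesis
        unfolding refn_def
      proof (intro conjI allI impI)
        show "h' \<in> vecs ?L ?n"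
          using hv by (auto simp: vecs_def h'_def min_in_lipc zero_in_lipc)
        show "h' s ?L \<le> l" for s
          using h by (auto simp: h'_def hL refn_def)
        show "mono \<rho>'"
        proof (rule monoI)
          fix x y :: nat assume "x \<le> y"
          moreover from this have "\<rho> x \<le> \<rho> y" using h by (simp add: refn_def mono_def)
          ultimately show "\<rho>' x \<le> \<rho>' y" by (auto simp: \<rho>'_def)
        qed
        show "\<exists>s<?n. \<rho>' s = t \<and> h' s ?L = l" if t: "t < Suc m" for t
        proof (cases "t = m")
          case True
          then show ?thesis by (intro exI[of _ n']) (simp add: \<rho>'_def h'_def)
        next
          case False
          then have "t < m" using t by simp
          then obtain s where "s < n'" "\<rho> s = t" "h s L' = l" using h by (auto simp: refn_def)
          then show ?thesis using \<open>t < m\<close> hL by (intro exI[of _ s]) (simp add: \<rho>'_def h'_def)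
        qed
      qed
    qed
    show "\<exists>g \<tau>. refn L n l (Suc m) g \<tau> \<and> ?inv (Suc m) C g \<tau>"
    proof (intro exI[of _ "act g \<tau> h'"] exI[of _ "\<rho>' \<circ> \<tau>"] conjI allI impI)
      show "refn L n l (Suc m) (act g \<tau> h') (\<rho>' \<circ> \<tau>)" using g h' by (rule refn_comp)
      fix F F' U i
      assume i: "1 \<le> i" "i < k" and U: "convex_set U" and F: "F \<in> vecs l (Suc m)" "F' \<in> vecs l (Suc m)"
        and top: "top_on U l F i" "top_on U l F' i" and eq: "\<forall>s. s \<notin> U \<longrightarrow> F s = F' s"
      have "C (act g \<tau> (act h' \<rho>' F)) = C (act g \<tau> (act h' \<rho>' F'))"
      \<comment> \<open>An interval containing \<open>m\<close> becomes an upset once positions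
        beyond \<open>m\<close>, where the vectors vanish, are added. If
        \<open>m \<notin> U\<close>, only the part of \<open>U\<close> below \<open>m\<close>
        matters, and the unchanged component at \<open>m\<close> is part of the colour
        \<open>D\<close>.\<close>
      proof (cases "m \<in> U")
        case True
        let ?U = "U \<union> {m..}"
        have "upset ?U"
          unfolding upset_def
        proof (intro ballI allI impI)
          fix s t assume "s \<in> ?U" "s \<le> t"
          moreover have "t \<in> U" if "s \<in> U" "s \<le> t" "t \<le> m"
            using that U True unfolding convex_set_def by blast
          ultimately show "t \<in> ?U" by force
        qed
        have "U \<inter> {..<Suc m} = ?U \<inter> {..<Suc m}" using True by (auto simp: less_Suc_eq_le)
        then have top': "top_on ?U l F i" "top_on ?U l F' i"
          using top_on_nonzero_part[OF _ i(1)] F top by blast+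
        show ?thesis
        proof (rule suf[OF i])
          show "upset (\<rho>' -` ?U)" using \<open>upset ?U\<close> h' by (intro upset_vimage) (simp_all add: refn_def)
          show "act h' \<rho>' F \<in> vecs ?L ?n" "act h' \<rho>' F' \<in> vecs ?L ?n"
            using F act_vecs[OF refn_vecs[OF h']] by blast+
          show "top_on (\<rho>' -` ?U) ?L (act h' \<rho>' F) i" "top_on (\<rho>' -` ?U) ?L (act h' \<rho>' F') i"
            using top_on_act[OF h' _ _ i(1)] F top' by blast+
          show "\<forall>s. s \<notin> \<rho>' -` ?U \<longrightarrow> act h' \<rho>' F s = act h' \<rho>' F' s"
            using eq by (auto simp: act_def)
        qed
      next
        case False
        have split: "act h' \<rho>' G = (act h \<rho> (G(m := (\<lambda>_. 0))))(n' := G m)" if G: "G \<in> vecs l (Suc m)" for G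
        proof
          fix s
          have G0: "G (\<rho> s) = (\<lambda>_. 0)" if "\<rho> s > m" using G that by (simp add: vecs_def)
          have z: "G t 0 = 0" for t by (rule vecs_zero[OF G])
          have "h s = (\<lambda>_. 0)" if "s > n'" using h that by (simp add: refn_def vecs_def)
          moreover have "G m \<circ> min l = G m" using G by (intro lipc_min vecs_lipc)
          ultimately show "act h' \<rho>' G s = ((act h \<rho> (G(m := (\<lambda>_. 0))))(n' := G m)) s"
            using G0 z by (auto simp: act_def h'_def \<rho>'_def comp_def)
        qed
        let ?F = "F(m := (\<lambda>_. 0))" and ?F' = "F'(m := (\<lambda>_. 0))"
        have vecs': "G(m := (\<lambda>_. 0)) \<in> vecs l m" if "G \<in> vecs l (Suc m)" for G
          using that by (auto simp: vecs_def zero_in_lipc Suc_le_eq)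
        have top': "top_on (U \<inter> {..<m}) l (G(m := (\<lambda>_. 0))) i" if "G \<in> vecs l (Suc m)" "top_on U l G i" for G
        proof (rule top_on_nonzero_part[OF _ i(1)])
          show "top_on U l (G(m := (\<lambda>_. 0))) i" using that False by (auto simp: top_on_def)
          show "G(m := (\<lambda>_. 0)) \<in> vecs l m" using that by (intro vecs')
        qed auto
        have "convex_set (U \<inter> {..<m})" using U by (fastforce simp: convex_set_def)
        moreover have "\<forall>s. s \<notin> U \<inter> {..<m} \<longrightarrow> ?F s = ?F' s"
        proof (intro allI impI)
          fix s assume "s \<notin> U \<inter> {..<m}"
          then consider "s \<notin> U" | "s = m" | "s > m" by force
          then show "?F s = ?F' s" using eq F by cases (auto simp: vecs_def)
        qed
        ultimately have "D (act h \<rho> ?F) = D (act h \<rho> ?F')"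
          using inv i top'[OF F(1) top(1)] top'[OF F(2) top(2)] vecs'[OF F(1)] vecs'[OF F(2)] by blast
        from enc(2)[OF _ _ this[unfolded D_def], of "F m"] C F
        have "C (act g \<tau> ((act h \<rho> ?F)(n' := F m))) = C (act g \<tau> ((act h \<rho> ?F')(n' := F m)))"
          by (simp add: vecs_lipc)
        moreover have "F m = F' m" using eq False by blast
        ultimately show ?thesis using split[OF F(1)] split[OF F(2)] by simp
      qed
      then show "C (act (act g \<tau> h') (\<rho>' \<circ> \<tau>) F) = C (act (act g \<tau> h') (\<rho>' \<circ> \<tau>) F')"
        by (simp only: act_act)
    qed
  qed
qed

section \<open>Pyramids\<close>

text \<open>
  Grouping \<open>2 h\<close> consecutive blocks with heights \<open>1, \<dots>, h, h, \<dots>, 1\<close> places a word of rank exactly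
  \<open>k - 1\<close> on both sides of every image of rank \<open>k\<close>; by interval invariance it absorbs neighbouring
  blocks of rank less than \<open>k\<close>.
\<close>

definition pyramid :: "nat \<Rightarrow> nat \<Rightarrow> nat \<Rightarrow> nat \<Rightarrow> nat" where
  "pyramid h n s = (if s < n
     then min (if s mod (2 * h) < h then Suc (s mod (2 * h)) else 2 * h - s mod (2 * h))
     else (\<lambda>_. 0))"

abbreviation stack :: "nat \<Rightarrow> nat \<Rightarrow> (nat \<Rightarrow> nat \<Rightarrow> nat) \<Rightarrow> nat \<Rightarrow> nat \<Rightarrow> nat" where
  "stack h M \<equiv> act (pyramid h (M * (2 * h))) (\<lambda>s. s div (2 * h))"

lemma div_mult_offset: "j < w \<Longrightarrow> (t * w + j) div w = t" for w :: nat
  by simp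

lemma mod_mult_offset: "j < w \<Longrightarrow> (t * w + j) mod w = j" for w :: nat
  by simp

lemma refn_pyramid:
  assumes h: "1 \<le> h"
  shows "refn h (M * (2 * h)) h M (pyramid h (M * (2 * h))) (\<lambda>s. s div (2 * h))"
  unfolding refn_def
proof (intro conjI allI impI)
  have "(if s mod (2 * h) < h then Suc (s mod (2 * h)) else 2 * h - s mod (2 * h)) \<le> h" for s
    by auto
  then show "pyramid h (M * (2 * h)) \<in> vecs h (M * (2 * h))"
    by (auto simp: vecs_def pyramid_def zero_in_lipc intro!: min_in_lipc)
  show "pyramid h (M * (2 * h)) s h \<le> h" for s by (simp add: pyramid_def)
  show "mono (\<lambda>s. s div (2 * h))" by (simp add: mono_def div_le_mono)
  show "\<exists>s<M * (2 * h). s div (2 * h) = t \<and> pyramid h (M * (2 * h)) s h = h" if "t < M" for t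
  proof -
    \<comment> \<open>Offset \<open>h - 1\<close> is the first of the two summits of height
      \<open>h\<close>.\<close>
    define s where "s = t * (2 * h) + (h - 1)"
    have s: "s div (2 * h) = t" "s mod (2 * h) = h - 1"
      unfolding s_def by (rule div_mult_offset mod_mult_offset; use h in simp)+
    moreover have "s < M * (2 * h)" using s(1) that h div_less_iff_less_mult[of "2 * h" s M] by simp
    ultimately show ?thesis using h by (intro exI[of _ s]) (simp add: pyramid_def)
  qed
qed

context
  fixes D :: "(nat \<Rightarrow> nat \<Rightarrow> nat) \<Rightarrow> nat" and h M k :: nat
  assumes h: "1 \<le> h" and k: "1 \<le> k"
    and inv: "\<And>F F' U i. 1 \<le> i \<Longrightarrow> i < k \<Longrightarrow> convex_set U \<Longrightarrow> F \<in> vecs h (M * (2 * h)) \<Longrightarrow>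
      F' \<in> vecs h (M * (2 * h)) \<Longrightarrow> top_on U h F i \<Longrightarrow> top_on U h F' i \<Longrightarrow>
      (\<forall>s. s \<notin> U \<longrightarrow> F s = F' s) \<Longrightarrow> D F = D F'"
begin

text \<open>Rank \<open>k - 1\<close> is attained on \<open>U\<close> outside the erased block and
  never exceeded there. It is thus the rank on \<open>U\<close> both before and after erasing, and
  invariance applies with \<open>i = k - 1\<close>, which is positive because
  \<open>2 \<le> k\<close>.\<close>

lemma erase_in_interval:
  assumes F: "F \<in> vecs h M" and 2: "2 \<le> k" and U: "convex_set U"
    and cover: "\<And>s. s div (2 * h) = s0 \<Longrightarrow> s \<in> U"
    and below: "\<And>s. s \<in> U \<Longrightarrow> stack h M F s h < k"
    and wit: "s1 \<in> U" "s1 div (2 * h) \<noteq> s0" "stack h M F s1 h = k - 1"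
  shows "D (stack h M F) = D (stack h M (F(s0 := (\<lambda>_. 0))))"
proof (rule inv[OF _ _ U])
  show "1 \<le> k - 1" "k - 1 < k" using 2 by auto
  let ?F = "F(s0 := (\<lambda>_. 0))"
  have F': "?F \<in> vecs h M" using F by (auto simp: vecs_def zero_in_lipc)
  show "stack h M F \<in> vecs h (M * (2 * h))" "stack h M ?F \<in> vecs h (M * (2 * h))"
    using act_vecs[OF refn_vecs[OF refn_pyramid[OF h]]] F F' by blast+
  show "top_on U h (stack h M F) (k - 1)"
    using below wit by (fastforce simp: top_on_def)
  have "stack h M ?F s h \<le> k - 1" if "s \<in> U" for s
  proof -
    have "stack h M ?F s h \<le> stack h M F s h" by (simp add: act_def)
    then show ?thesis using below[OF that] by linarith
  qed
  moreover have "stack h M ?F s1 h = k - 1" using wit by (simp add: act_def)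
  ultimately show "top_on U h (stack h M ?F) (k - 1)"
    using wit(1) unfolding top_on_def by blast
  show "\<forall>s. s \<notin> U \<longrightarrow> stack h M F s = stack h M ?F s"
    using cover by (auto simp: act_def)
qed

text \<open>The interval runs from \<open>s0\<close> to the nearest block of rank \<open>k\<close>,
  to the right if there is one and otherwise to the left, and continues along the facing slope of
  that pyramid for as long as the rank stays below \<open>k\<close>. The slope takes every height
  from 1 to \<open>h\<close>, so this stretch contains a component of rank exactly
  \<open>k - 1\<close>.\<close>

lemma erase_one:
  assumes F: "F \<in> vecs h M" and le: "\<And>s. F s h \<le> k" and ex: "F s1 h = k" and s0: "F s0 h < k"
  shows "D (stack h M F) = D (stack h M (F(s0 := (\<lambda>_. 0))))"
proof (cases "2 \<le> k")
  case False
  then have "F s0 = (\<lambda>_. 0)" using s0 by (intro vecs_eq_zero[OF F]) simp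
  then have "F(s0 := (\<lambda>_. 0)) = F" by auto
  then show ?thesis by simp
next
  case True
  let ?W = "2 * h"
  have W: "0 < ?W" using h by simp
  have lt_M: "s < M" if "F s h = k" for s
  proof (rule ccontr)
    assume "\<not> s < M"
    then have "F s h = 0" using F by (simp add: vecs_def)
    then show False using that k by simp
  qed
  have lip: "lip (F s)" for s using F vecs_lipc lipc_lip by blast
  have val: "stack h M F s h \<le> F (s div ?W) h" for s
    by (simp add: act_def) (rule lipc_le[OF vecs_lipc[OF F]])
  have in_range: "s < M * ?W" if "s div ?W < M" for s
    using that W div_less_iff_less_mult[of ?W s M] by simp
  show ?thesis
  proof (cases "\<exists>s. s0 < s \<and> F s h = k")
    case ex: True
    define s1 where "s1 = (LEAST s. s0 < s \<and> F s h = k)"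
    have s1: "s0 < s1" "F s1 h = k" using LeastI_ex[OF ex] by (auto simp: s1_def)
    have before: "F s h < k" if "s0 \<le> s" "s < s1" for s
      using not_less_Least[of s "\<lambda>s. s0 < s \<and> F s h = k"] that s0 le[of s]
      unfolding s1_def[symmetric] by (cases "s = s0") auto
    \<comment> \<open>On the ascending slope the height is \<open>Suc (s mod ?W)\<close>. Since
      \<open>F s1\<close> is monotone, the last condition selects an initial stretch of the slope,
      which keeps \<open>U\<close> convex.\<close>
    define U where "U = {s. s0 \<le> s div ?W \<and>
      (s div ?W < s1 \<or> s div ?W = s1 \<and> s mod ?W < h \<and> F s1 (Suc (s mod ?W)) < k)}"
    obtain y where y: "y \<le> h" "F s1 y = k - 1" using lip_surj[OF lip, of "k - 1" s1 h] s1 by auto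
    have "y \<noteq> 0"
    proof
      assume "y = 0"
      then show False using y(2) True vecs_zero[OF F] by simp
    qed
    then obtain j where j: "y = Suc j" by (cases y) auto
    show ?thesis
    proof (rule erase_in_interval[OF F True, of U s0 "s1 * ?W + j"])
      show "convex_set U"
        unfolding convex_set_def
      proof (intro ballI allI impI)
        fix a b c assume ab: "a \<in> U" "b \<in> U" "a \<le> c" "c \<le> b"
        have div: "a div ?W \<le> c div ?W" "c div ?W \<le> b div ?W" using ab by (simp_all add: div_le_mono)
        show "c \<in> U"
        proof (cases "c div ?W = b div ?W")
          case True
          then have "c mod ?W \<le> b mod ?W" using ab(4) by (metis add_le_cancel_left mult_div_mod_eq)
          then have "F s1 (Suc (c mod ?W)) \<le> F s1 (Suc (b mod ?W))" by (intro lip_mono[OF lip]) simp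
          then show ?thesis using ab div True \<open>c mod ?W \<le> b mod ?W\<close> by (auto simp: U_def)
        next
          case False
          then show ?thesis using ab div by (auto simp: U_def)
        qed
      qed
      show "s \<in> U" if "s div ?W = s0" for s using that s1 by (simp add: U_def)
      show "stack h M F s h < k" if "s \<in> U" for s
      proof (cases "s div ?W < s1")
        case True
        then show ?thesis using before[of "s div ?W"] val[of s] that by (auto simp: U_def)
      next
        case False
        then have *: "s div ?W = s1" "s mod ?W < h" "F s1 (Suc (s mod ?W)) < k" using that by (auto simp: U_def)
        then have "s < M * ?W" using in_range lt_M[OF s1(2)] by simp
        then show ?thesis using * by (simp add: act_def pyramid_def)
      qed
      have jh: "j < h" using y j by simp
      then have *: "(s1 * ?W + j) div ?W = s1" "(s1 * ?W + j) mod ?W = j" using h by simp_all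
      show "s1 * ?W + j \<in> U" using * jh y j s1 True by (simp add: U_def)
      show "(s1 * ?W + j) div ?W \<noteq> s0" using * s1 by simp
      have "s1 * ?W + j < M * ?W" using in_range lt_M[OF s1(2)] * by simp
      then show "stack h M F (s1 * ?W + j) h = k - 1" using * jh y j by (simp add: act_def pyramid_def)
    qed
  next
    case no: False
    define s2 where "s2 = Max {s. s < s0 \<and> F s h = k}"
    have "s1 < s0" using ex no s0 by (metis linorder_neqE_nat less_irrefl)
    then have "{s. s < s0 \<and> F s h = k} \<noteq> {}" using ex by blast
    then have s2: "s2 < s0" "F s2 h = k"
      using Max_in[of "{s. s < s0 \<and> F s h = k}"] by (auto simp: s2_def)
    have between: "F s h < k" if "s2 < s" "s \<le> s0" for s
    proof (cases "s = s0")
      case False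
      have "\<not> s \<le> s2" using that by simp
      then have "s \<notin> {s. s < s0 \<and> F s h = k}" unfolding s2_def by (metis Max_ge finite_Collect_conjI finite_Collect_less_nat)
      then show ?thesis using that False le[of s] by auto
    qed (use s0 in simp)
    \<comment> \<open>The mirror image: on the descending slope the height is
      \<open>?W - s mod ?W\<close>, and the condition selects a final stretch.\<close>
    define U where "U = {s. s div ?W \<le> s0 \<and>
      (s2 < s div ?W \<or> s div ?W = s2 \<and> h \<le> s mod ?W \<and> F s2 (?W - s mod ?W) < k)}"
    obtain y where y: "y \<le> h" "F s2 y = k - 1" using lip_surj[OF lip, of "k - 1" s2 h] s2 by auto
    have "y \<noteq> 0"
    proof
      assume "y = 0"
      then show False using y(2) True vecs_zero[OF F] by simp
    qed
    \<comment> \<open>The offset on the descending slope at which the height is \<open>y\<close>; it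
      lies inside the block because \<open>y \<noteq> 0\<close>.\<close>
    define j where "j = ?W - y"
    show ?thesis
    proof (rule erase_in_interval[OF F True, of U s0 "s2 * ?W + j"])
      show "convex_set U"
        unfolding convex_set_def
      proof (intro ballI allI impI)
        fix a b c assume ab: "a \<in> U" "b \<in> U" "a \<le> c" "c \<le> b"
        have div: "a div ?W \<le> c div ?W" "c div ?W \<le> b div ?W" using ab by (simp_all add: div_le_mono)
        show "c \<in> U"
        proof (cases "c div ?W = a div ?W")
          case True
          then have "a mod ?W \<le> c mod ?W" using ab(3) by (metis add_le_cancel_left mult_div_mod_eq)
          then have "F s2 (?W - c mod ?W) \<le> F s2 (?W - a mod ?W)" by (intro lip_mono[OF lip]) simp
          then show ?thesis using ab div True \<open>a mod ?W \<le> c mod ?W\<close> by (auto simp: U_def)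
        next
          case False
          then show ?thesis using ab div by (auto simp: U_def)
        qed
      qed
      show "s \<in> U" if "s div ?W = s0" for s using that s2 by (simp add: U_def)
      show "stack h M F s h < k" if "s \<in> U" for s
      proof (cases "s2 < s div ?W")
        case True
        then show ?thesis using between[of "s div ?W"] val[of s] that by (auto simp: U_def)
      next
        case False
        then have *: "s div ?W = s2" "h \<le> s mod ?W" "F s2 (?W - s mod ?W) < k" using that by (auto simp: U_def)
        then have "s < M * ?W" using in_range lt_M[OF s2(2)] by simp
        then show ?thesis using * by (simp add: act_def pyramid_def)
      qed
      have jh: "h \<le> j" "j < ?W" "?W - j = y" using y(1) \<open>y \<noteq> 0\<close> h by (auto simp: j_def)
      then have *: "(s2 * ?W + j) div ?W = s2" "(s2 * ?W + j) mod ?W = j" by simp_all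
      show "s2 * ?W + j \<in> U" using * jh y s2 True by (simp add: U_def)
      show "(s2 * ?W + j) div ?W \<noteq> s0" using * s2 by simp
      have "s2 * ?W + j < M * ?W" using in_range lt_M[OF s2(2)] * by simp
      then show "stack h M F (s2 * ?W + j) h = k - 1" using * jh y by (simp add: act_def pyramid_def)
    qed
  qed
qed

text \<open>Low blocks are erased one at a time. The block \<open>s1\<close> of rank
  \<open>k\<close> remains throughout, so each erasure still finds a slope to lean on.\<close>

lemma erase_low_blocks:
  assumes F: "F \<in> vecs h M" and le: "\<And>s. F s h \<le> k" and ex: "F s1 h = k"
  shows "D (stack h M F) = D (stack h M (\<lambda>s. if F s h = k then F s else (\<lambda>_. 0)))"
proof -
  have "D (stack h M F) = D (stack h M (\<lambda>s. if s \<in> Z then (\<lambda>_. 0) else F s))"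
    if "finite Z" "Z \<subseteq> {s. F s h < k}" for Z
    using that
  proof (induction Z)
    case (insert z Z)
    let ?G = "\<lambda>s. if s \<in> Z then (\<lambda>_. 0) else F s"
    have "D (stack h M ?G) = D (stack h M (?G(z := (\<lambda>_. 0))))"
    proof (rule erase_one)
      show "?G \<in> vecs h M" using F zero_in_vecs by (auto simp: vecs_def zero_in_lipc)
      show "?G s1 h = k" using ex insert.prems by auto
      show "?G z h < k" using insert.prems k by auto
    qed (use le in auto)
    moreover have "?G(z := (\<lambda>_. 0)) = (\<lambda>s. if s \<in> insert z Z then (\<lambda>_. 0) else F s)" by auto
    ultimately show ?case using insert by simp
  qed simp
  note erase = this
  have "{s. s < M \<and> F s h < k} \<subseteq> {s. F s h < k}" by blast
  from erase[OF _ this]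
  have "D (stack h M F) = D (stack h M (\<lambda>s. if s < M \<and> F s h < k then (\<lambda>_. 0) else F s))" by simp
  also have "(\<lambda>s. if s < M \<and> F s h < k then (\<lambda>_. 0) else F s) = (\<lambda>s. if F s h = k then F s else (\<lambda>_. 0))"
  proof
    fix s
    have "F s = (\<lambda>_. 0)" if "\<not> s < M" using F that by (simp add: vecs_def)
    then show "(if s < M \<and> F s h < k then (\<lambda>_. 0) else F s) = (if F s h = k then F s else (\<lambda>_. 0))"
      using le[of s] by auto
  qed
  finally show ?thesis .
qed

end

section \<open>Thinning\<close>

text \<open>The counting function of \<open>A\<close>. A nondecreasing 1-Lipschitz map fixing 0 is
  the counting function of the places where it increases, which turns maps of rank \<open>k\<close>
  into \<open>k\<close>-element sets.\<close>

definition jump :: "nat set \<Rightarrow> nat \<Rightarrow> nat" where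
  "jump A x = card (A \<inter> {..x})"

lemma jump_Suc: "jump A (Suc x) = (if Suc x \<in> A then Suc (jump A x) else jump A x)"
proof -
  have "A \<inter> {..Suc x} = (if Suc x \<in> A then insert (Suc x) (A \<inter> {..x}) else A \<inter> {..x})"
    by (auto simp: le_Suc_eq)
  then show ?thesis by (simp add: jump_def)
qed

lemma jump_top: "A \<subseteq> {1..L} \<Longrightarrow> L \<le> x \<Longrightarrow> jump A x = card A"
  unfolding jump_def by (intro arg_cong[of _ _ card]) auto

lemma jump_in_lipc:
  assumes "A \<subseteq> {1..L}"
  shows "jump A \<in> lipc L"
proof (rule lipcI)
  have "A \<inter> {..0} = {}" using assms by auto
  then show "lip (jump A)" unfolding lip_def by (auto simp: jump_Suc jump_def[of A 0])
qed (simp add: jump_top[OF assms])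

text \<open>The composite can increase only where \<open>jump H\<close> does, that is on
  \<open>H\<close>; the set \<open>A\<close> collects those places where the increase survives
  \<open>f\<close>.\<close>

lemma comp_jump:
  assumes f: "lip f" and H: "0 \<notin> H"
  obtains A where "A \<subseteq> H" "f \<circ> jump H = jump A"
proof -
  define A where "A = {a \<in> H. f (jump H a) = Suc (f (jump H (a - 1)))}"
  have "f (jump H x) = jump A x" for x
  proof (induction x)
    case 0
    have "H \<inter> {..0} = {}" "A \<inter> {..0} = {}" using H by (auto simp: A_def)
    then show ?case using f by (simp add: jump_def lip_def)
  next
    case (Suc x)
    have "f (Suc (jump H x)) = f (jump H x) \<or> f (Suc (jump H x)) = Suc (f (jump H x))"
      using f by (metis le_SucE le_antisym lip_def)
    then show ?case using Suc by (auto simp: jump_Suc A_def)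
  qed
  then have "f \<circ> jump H = jump A" by (intro ext) simp
  moreover have "A \<subseteq> H" by (auto simp: A_def)
  ultimately show thesis by (rule that[rotated])
qed

text \<open>The bounds are fixed in the reverse order of the refinements: the number
  \<open>M\<close> of blocks for the unions theorem, then the height \<open>h\<close> for product
  Ramsey, then \<open>n\<close> and \<open>L\<close> for interval invariance on
  \<open>M * (2 * h)\<close> blocks.\<close>

lemma gowers_step:
  assumes k: "1 \<le> k" and IH: "\<forall>i. 1 \<le> i \<longrightarrow> i < k \<longrightarrow> gowers_at i"
  shows "gowers_at k"
  unfolding gowers_at_def
proof (intro allI)
  fix m l r :: nat
  show "\<exists>n L. \<forall>C. (\<forall>F. C F < r) \<longrightarrow> (\<exists>g \<tau>. refn L n l m g \<tau> \<and>
       (\<forall>F\<in>ranked l m k. \<forall>F'\<in>ranked l m k. C (act g \<tau> F) = C (act g \<tau> F')))"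
  proof (cases "k \<le> l")
    case False
    have "F \<notin> ranked l m k" for F
    proof
      assume F: "F \<in> ranked l m k"
      then obtain s where "F s l = k" by (auto simp: ranked_def top_on_def)
      moreover have "F s l \<le> l" using F by (intro lipc_le_height) (simp add: ranked_def vecs_def)
      ultimately show False using False by simp
    qed
    then show ?thesis using refn_id by blast
  next
    case kl: True
    obtain M where M: "\<forall>\<chi> :: nat set \<Rightarrow> nat. (\<forall>X. \<chi> X < r) \<longrightarrow>
       (\<exists>\<Sigma> \<subseteq> {..<M}. \<exists>\<tau> :: nat \<Rightarrow> nat. mono \<tau> \<and> (\<forall>t<m. \<exists>s\<in>\<Sigma>. \<tau> s = t) \<and>
        (\<exists>j. \<forall>T \<subseteq> {..<m}. T \<noteq> {} \<longrightarrow> \<chi> {s \<in> \<Sigma>. \<tau> s \<in> T} = j))"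
      using finite_block_unions[of r m] by (elim exE)
    obtain enc :: "(nat set \<Rightarrow> nat) \<Rightarrow> nat" and q where
      enc: "\<And>\<phi>. (\<And>j. \<phi> j < r) \<Longrightarrow> enc \<phi> < q"
        "\<And>\<phi> \<psi> S. (\<And>j. \<phi> j < r) \<Longrightarrow> (\<And>j. \<psi> j < r) \<Longrightarrow> enc \<phi> = enc \<psi> \<Longrightarrow> S \<in> Pow {..<M} \<Longrightarrow> \<phi> S = \<psi> S"
      by (rule colour_product[of "Pow {..<M}" r]) auto
    obtain h0 where h0: "\<forall>\<chi> :: (nat \<Rightarrow> nat set) \<Rightarrow> nat. (\<forall>A. \<chi> A < q) \<longrightarrow>
       (\<exists>H. (\<forall>s<M. H s \<subseteq> {1..h0} \<and> card (H s) = l) \<and>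
        (\<exists>j. \<forall>A. (\<forall>s<M. A s \<subseteq> H s \<and> card (A s) = k) \<longrightarrow> (\<forall>s\<ge>M. A s = {}) \<longrightarrow> \<chi> A = j))"
      using product_ramsey[of q M l k] by (elim exE)
    \<comment> \<open>\<open>Suc\<close> gives the pyramids positive height even if
      \<open>h0 = 0\<close>.\<close>
    define h where "h = Suc h0"
    have h: "1 \<le> h" by (simp add: h_def)
    obtain n L where nL: "\<forall>C. (\<forall>F. C F < r) \<longrightarrow> (\<exists>g \<tau>. refn L n h (M * (2 * h)) g \<tau> \<and>
       (\<forall>F F' U i. 1 \<le> i \<longrightarrow> i < k \<longrightarrow> convex_set U \<longrightarrow> F \<in> vecs h (M * (2 * h)) \<longrightarrow> F' \<in> vecs h (M * (2 * h)) \<longrightarrow>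
        top_on U h F i \<longrightarrow> top_on U h F' i \<longrightarrow> (\<forall>s. s \<notin> U \<longrightarrow> F s = F' s) \<longrightarrow>
        C (act g \<tau> F) = C (act g \<tau> F')))"
      using interval_invariance[OF IH, of r h "M * (2 * h)"] by (elim exE)
    show ?thesis
    proof (rule exI[of _ n], rule exI[of _ L], intro allI impI)
      fix C :: "(nat \<Rightarrow> nat \<Rightarrow> nat) \<Rightarrow> nat" assume C: "\<forall>F. C F < r"
      from nL[THEN spec, THEN mp, OF C] obtain g1 \<tau>1 where r1: "refn L n h (M * (2 * h)) g1 \<tau>1"
        and inv: "\<And>F F' U i. 1 \<le> i \<Longrightarrow> i < k \<Longrightarrow> convex_set U \<Longrightarrow> F \<in> vecs h (M * (2 * h)) \<Longrightarrow>
          F' \<in> vecs h (M * (2 * h)) \<Longrightarrow> top_on U h F i \<Longrightarrow> top_on U h F' i \<Longrightarrow>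
          (\<forall>s. s \<notin> U \<longrightarrow> F s = F' s) \<Longrightarrow> C (act g1 \<tau>1 F) = C (act g1 \<tau>1 F')"
        by blast
      define D where "D F = C (act g1 \<tau>1 F)" for F
      have D: "D F < r" for F using C by (simp add: D_def)
      \<comment> \<open>\<open>S\<close> is the set of blocks that carry a component. Product Ramsey
        will be applied to \<open>E A\<close> as a function of \<open>S\<close>, so that one family
        \<open>H\<close> serves all \<open>S\<close> simultaneously.\<close>
      define E where "E A S = D (stack h M (\<lambda>s. if s \<in> S then jump (A s) else (\<lambda>_. 0)))" for A S
      have E: "E A S < r" for A S by (simp add: E_def D)
      have "\<forall>A. enc (E A) < q" using enc(1) E by blast
      from h0[THEN spec, THEN mp, OF this] obtain H j where
        H: "\<And>s. s < M \<Longrightarrow> H s \<subseteq> {1..h0}" "\<And>s. s < M \<Longrightarrow> card (H s) = l"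
        and j: "\<And>A. (\<forall>s<M. A s \<subseteq> H s \<and> card (A s) = k) \<Longrightarrow> (\<forall>s\<ge>M. A s = {}) \<Longrightarrow> enc (E A) = j"
        by blast
      have Hh: "H s \<subseteq> {1..h}" if "s < M" for s using H(1)[OF that] by (auto simp: h_def)
      have "\<exists>A. A \<subseteq> H s \<and> card A = k" if "s < M" for s
        using H(2)[OF that] kl by (metis obtain_subset_with_card_n)
      then obtain B where B: "\<And>s. s < M \<Longrightarrow> B s \<subseteq> H s \<and> card (B s) = k" by metis
      \<comment> \<open>Any admissible family can serve as reference: by homogeneity of
        \<open>H\<close>, replacing it by another leaves all colours \<open>E A S\<close> with
        \<open>S \<subseteq> {..<M}\<close> unchanged.\<close>
      define A0 where "A0 s = (if s < M then B s else {})" for s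
      have A0: "\<forall>s<M. A0 s \<subseteq> H s \<and> card (A0 s) = k" "\<forall>s\<ge>M. A0 s = {}" using B by (simp_all add: A0_def)
      have "\<forall>S. E A0 S < r" using E by simp
      from M[THEN spec, THEN mp, OF this] obtain \<Sigma> \<tau>4 i where \<Sigma>: "\<Sigma> \<subseteq> {..<M}"
        and \<tau>4: "mono \<tau>4" "\<forall>t<m. \<exists>s\<in>\<Sigma>. \<tau>4 s = t"
        and i: "\<forall>T \<subseteq> {..<m}. T \<noteq> {} \<longrightarrow> E A0 {s \<in> \<Sigma>. \<tau>4 s \<in> T} = i"
        by (elim exE conjE) (rule that)
      \<comment> \<open>\<open>g3\<close> thins height \<open>h\<close> to the \<open>l\<close>
        levels in \<open>H s\<close>; \<open>g4\<close> retains the blocks in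
        \<open>\<Sigma>\<close>, which \<open>\<tau>4\<close> groups into new blocks.\<close>
      define g3 where "g3 s = (if s < M then jump (H s) else (\<lambda>_. 0))" for s
      define g4 where "g4 s = (if s \<in> \<Sigma> then min l else (\<lambda>_. 0))" for s
      have r3: "refn h M l M g3 id"
        using Hh H(2) jump_top[of "H _" h h]
        by (auto simp: refn_def vecs_def g3_def zero_in_lipc jump_in_lipc mono_def)
      have r4: "refn l M l m g4 \<tau>4"
        unfolding refn_def
      proof (intro conjI allI impI)
        show "g4 \<in> vecs l M" using \<Sigma> by (auto simp: vecs_def g4_def zero_in_lipc min_in_lipc)
        show "\<exists>s<M. \<tau>4 s = t \<and> g4 s l = l" if "t < m" for t
          using \<tau>4(2) that \<Sigma> by (auto simp: g4_def)
      qed (auto simp: g4_def \<tau>4)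
      note r2 = refn_pyramid[OF h, of M]
      let ?g = "act g1 \<tau>1 (act (pyramid h (M * (2 * h))) (\<lambda>s. s div (2 * h)) (act g3 id g4))"
      let ?\<tau> = "((\<tau>4 \<circ> id) \<circ> (\<lambda>s. s div (2 * h))) \<circ> \<tau>1"
      have ref: "refn L n l m ?g ?\<tau>" by (intro refn_comp[OF r1] refn_comp[OF r2] refn_comp[OF r3] r4)
      have "C (act ?g ?\<tau> F) = i" if F: "F \<in> ranked l m k" for F
      proof -
        define G where "G = act g3 id (act g4 \<tau>4 F)"
        define T where "T = {t. F t l = k}"
        define S where "S = {s \<in> \<Sigma>. \<tau>4 s \<in> T}"
        have Fv: "F \<in> vecs l m" using F by (simp add: ranked_def)
        have Gv: "G \<in> vecs h M"
          unfolding G_def by (rule act_vecs[OF refn_vecs[OF r3] act_vecs[OF refn_vecs[OF r4] Fv]])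
        have G: "G s = (if s \<in> \<Sigma> then F (\<tau>4 s) \<circ> jump (H s) else (\<lambda>_. 0))" for s
        proof (cases "s \<in> \<Sigma>")
          case True
          then have "s < M" using \<Sigma> by blast
          moreover have "F (\<tau>4 s) \<circ> min l = F (\<tau>4 s)" by (intro lipc_min vecs_lipc[OF Fv])
          ultimately show ?thesis using True by (simp add: G_def act_def g3_def g4_def)
        next
          case False
          then show ?thesis using vecs_zero[OF Fv] by (simp add: G_def act_def g3_def g4_def comp_def)
        qed
        have Gh: "G s h = (if s \<in> \<Sigma> then F (\<tau>4 s) l else 0)" for s
          using G[of s] \<Sigma> jump_top[OF Hh, of s h] H(2)[of s] by auto
        have GS: "G s h = k \<longleftrightarrow> s \<in> S" for s using Gh k by (auto simp: S_def T_def)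
        have Tm: "T \<subseteq> {..<m}"
        proof
          fix t assume "t \<in> T"
          then have "F t l \<noteq> 0" using k by (simp add: T_def)
          then show "t \<in> {..<m}" using Fv by (cases "t < m") (auto simp: vecs_def)
        qed
        obtain t where t: "t \<in> T" using F by (auto simp: ranked_def top_on_def T_def)
        then obtain s1 where "s1 \<in> \<Sigma>" "\<tau>4 s1 = t" using \<tau>4(2) Tm by (meson lessThan_iff subsetD)
        then have s1: "G s1 h = k" using t GS by (simp add: S_def)
        have Gle: "G s h \<le> k" for s using Gh[of s] F by (auto simp: ranked_def top_on_def)
        have "\<exists>A. A \<subseteq> H s \<and> F (\<tau>4 s) \<circ> jump (H s) = jump A" if "s \<in> S" for s
        proof -
          have "s < M" using \<Sigma> that by (auto simp: S_def)
          then have "0 \<notin> H s" using Hh[of s] by (meson atLeastAtMost_iff not_one_le_zero subsetD)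
          then show ?thesis using comp_jump[OF lipc_lip[OF vecs_lipc[OF Fv]], of "H s" "\<tau>4 s"] by metis
        qed
        then obtain A1 where A1: "\<And>s. s \<in> S \<Longrightarrow> A1 s \<subseteq> H s \<and> F (\<tau>4 s) \<circ> jump (H s) = jump (A1 s)" by metis
        \<comment> \<open>Off \<open>S\<close> the sets do not influence \<open>E A S\<close>;
          \<open>A0\<close> fills them in so that homogeneity can be applied to all \<open>M\<close>
          coordinates.\<close>
        define A where "A s = (if s \<in> S then A1 s else A0 s)" for s
        have "\<forall>s<M. A s \<subseteq> H s \<and> card (A s) = k"
        proof (intro allI impI)
          fix s assume sM: "s < M"
          show "A s \<subseteq> H s \<and> card (A s) = k"
          proof (cases "s \<in> S")
            case True
            have sub: "A1 s \<subseteq> {1..h}" using A1[OF True] Hh[OF sM] by blast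
            have "k = jump (A1 s) h" using GS[of s] True G[of s] A1[OF True] by (simp add: S_def)
            then have "card (A1 s) = k" using jump_top[OF sub, of h] by simp
            then show ?thesis using A1[OF True] True by (simp add: A_def)
          qed (use A0(1) sM in \<open>simp add: A_def\<close>)
        qed
        moreover have "\<forall>s\<ge>M. A s = {}" using A0(2) \<Sigma> by (auto simp: A_def S_def)
        ultimately have "enc (E A) = enc (E A0)" using j A0 by simp
        moreover have "S \<in> Pow {..<M}" using \<Sigma> by (auto simp: S_def)
        ultimately have EA: "E A S = E A0 S" using enc(2)[of "E A" "E A0" S] E by blast
        have "(\<lambda>s. if G s h = k then G s else (\<lambda>_. 0)) = (\<lambda>s. if s \<in> S then jump (A s) else (\<lambda>_. 0))"
          using GS G A1 by (auto simp: A_def S_def)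
        moreover have "D (stack h M G) = D (stack h M (\<lambda>s. if G s h = k then G s else (\<lambda>_. 0)))"
          using erase_low_blocks[OF h k, of M D G s1] inv Gv Gle s1 unfolding D_def by blast
        ultimately have "D (stack h M G) = E A S" by (simp add: E_def)
        also have "\<dots> = i"
        proof -
          have "T \<noteq> {}" using t by auto
          from i[rule_format, OF Tm this] have "E A0 S = i" unfolding S_def .
          then show ?thesis using EA by simp
        qed
        finally show ?thesis unfolding D_def G_def act_act[symmetric] .
      qed
      then show "\<exists>g \<tau>. refn L n l m g \<tau> \<and>
         (\<forall>F\<in>ranked l m k. \<forall>F'\<in>ranked l m k. C (act g \<tau> F) = C (act g \<tau> F'))"
        using ref by metis
    qed
  qed
qed

lemma gowers: "1 \<le> k \<Longrightarrow> gowers_at k"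
proof (induction k rule: less_induct)
  case (less k)
  then show ?case using gowers_step by blast
qed

section \<open>Block sequences\<close>

definition before :: "(nat \<Rightarrow> nat \<Rightarrow> nat) \<Rightarrow> (nat \<Rightarrow> nat \<Rightarrow> nat) \<Rightarrow> bool" where
  "before F G \<longleftrightarrow> (\<forall>s t. F s \<noteq> (\<lambda>_. 0) \<longrightarrow> G t \<noteq> (\<lambda>_. 0) \<longrightarrow> s < t)"

definition ranked_blocks :: "nat \<Rightarrow> nat \<Rightarrow> nat \<Rightarrow> nat \<Rightarrow> (nat \<Rightarrow> nat \<Rightarrow> nat) list set" where
  "ranked_blocks L n k d = {Ds. length Ds = d \<and> set Ds \<subseteq> ranked L n k \<and> sorted_wrt before Ds}"

lemma before_act:
  assumes "before F G" "F \<in> vecs l m" "G \<in> vecs l m" "mono \<tau>"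
  shows "before (act g \<tau> F) (act g \<tau> G)"
  unfolding before_def
proof (intro allI impI)
  fix s t assume "act g \<tau> F s \<noteq> (\<lambda>_. 0)" "act g \<tau> G t \<noteq> (\<lambda>_. 0)"
  then have "F (\<tau> s) \<noteq> (\<lambda>_. 0)" "G (\<tau> t) \<noteq> (\<lambda>_. 0)" by (auto simp: act_def comp_def)
  then have "\<tau> s < \<tau> t" using assms(1) by (simp add: before_def)
  then show "s < t" using assms(4) by (meson monoD not_less)
qed

text \<open>One block behind those of the induction hypothesis is reserved for a fixed last term
  \<open>z\<close>. Fusion replaces the true last term by \<open>z\<close>, as both have rank
  \<open>k\<close> and lie behind the other terms. What remains is a colouring of \<open>d\<close>
  terms.\<close>

lemma gowers_blocks:
  assumes k: "1 \<le> k"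
  shows "\<exists>n L. \<forall>C. (\<forall>Ds. C Ds < (r::nat)) \<longrightarrow> (\<exists>g \<tau>. refn L n l m g \<tau> \<and>
     (\<exists>j. \<forall>Ds\<in>ranked_blocks l m k d. C (map (act g \<tau>) Ds) = j))"
proof (induction d arbitrary: m)
  case 0
  have "ranked_blocks l m k 0 = {[]}" by (auto simp: ranked_blocks_def)
  then have "\<exists>g \<tau>. refn l m l m g \<tau> \<and> (\<exists>j. \<forall>Ds\<in>ranked_blocks l m k 0. C (map (act g \<tau>) Ds) = j)"
    for C :: "(nat \<Rightarrow> nat \<Rightarrow> nat) list \<Rightarrow> nat"
    using refn_id[of l m] by auto
  then show ?case by blast
next
  case (Suc d)
  obtain n' L' where IH: "\<forall>C. (\<forall>Ds. C Ds < r) \<longrightarrow> (\<exists>g \<tau>. refn L' n' l m g \<tau> \<and>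
     (\<exists>j. \<forall>Ds\<in>ranked_blocks l m k d. C (map (act g \<tau>) Ds) = j))"
    using Suc.IH[of m] by (elim exE)
  let ?L = "max k L'" and ?n = "Suc n'"
  let ?zero = "replicate d (\<lambda>_. 0) :: (nat \<Rightarrow> nat) list"
  \<comment> \<open>Rank \<open>k\<close> itself must be covered by the fusion, hence the bound
    \<open>Suc k\<close>.\<close>
  have all: "\<forall>i. 1 \<le> i \<longrightarrow> i < Suc k \<longrightarrow> gowers_at i" using gowers by blast
  obtain n L where nL: "\<forall>C :: (nat \<Rightarrow> (nat \<Rightarrow> nat) list) \<Rightarrow> (nat \<Rightarrow> nat \<Rightarrow> nat) \<Rightarrow> nat. (\<forall>P v. C P v < r) \<longrightarrow> (\<exists>g \<tau>. refn L n ?L ?n g \<tau> \<and>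
     (\<forall>P v v' U i. 1 \<le> i \<longrightarrow> i < Suc k \<longrightarrow> upset U \<longrightarrow> P \<in> prefixes d ?L ?n \<longrightarrow> v \<in> ranked ?L ?n i \<longrightarrow> v' \<in> ranked ?L ?n i \<longrightarrow>
        (\<forall>s\<in>U. P s = ?zero) \<longrightarrow> (\<forall>s. s \<notin> U \<longrightarrow> v s = (\<lambda>_. 0) \<and> v' s = (\<lambda>_. 0)) \<longrightarrow>
        C (act_list g \<tau> P) (act g \<tau> v) = C (act_list g \<tau> P) (act g \<tau> v')))"
    using fusion[OF all, of r ?L ?n d] by (elim exE)
  show ?case
  proof (rule exI[of _ n], rule exI[of _ L], intro allI impI)
    fix C :: "(nat \<Rightarrow> nat \<Rightarrow> nat) list \<Rightarrow> nat" assume C: "\<forall>Ds. C Ds < r"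
    define D where "D P v = C (map (\<lambda>i s. P s ! i) [0..<d] @ [v])" for P :: "nat \<Rightarrow> (nat \<Rightarrow> nat) list" and v
    have "\<forall>P v. D P v < r" using C by (simp add: D_def)
    from nL[THEN spec, THEN mp, OF this] obtain g \<tau> where g: "refn L n ?L ?n g \<tau>"
      and inv: "\<And>P v v' U i. 1 \<le> i \<Longrightarrow> i < Suc k \<Longrightarrow> upset U \<Longrightarrow> P \<in> prefixes d ?L ?n \<Longrightarrow> v \<in> ranked ?L ?n i \<Longrightarrow> v' \<in> ranked ?L ?n i \<Longrightarrow>
        (\<forall>s\<in>U. P s = ?zero) \<Longrightarrow> (\<forall>s. s \<notin> U \<longrightarrow> v s = (\<lambda>_. 0) \<and> v' s = (\<lambda>_. 0)) \<Longrightarrow>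
        D (act_list g \<tau> P) (act g \<tau> v) = D (act_list g \<tau> P) (act g \<tau> v')"
      by blast
    \<comment> \<open>The reserved block \<open>n'\<close> carries height \<open>k\<close>, which
      explains the maximum in \<open>?L\<close>.\<close>
    define z where "z s = (if s = n' then min k else (\<lambda>_. 0))" for s
    have z: "z \<in> ranked ?L ?n k"
      by (auto simp: z_def ranked_def vecs_def top_on_def zero_in_lipc min_in_lipc)
    have "\<forall>Ds. C (map (act g \<tau>) (Ds @ [z])) < r" using C by simp
    from IH[THEN spec, THEN mp, OF this] obtain h \<rho> j where h: "refn L' n' l m h \<rho>"
      and j: "\<And>Ds. Ds \<in> ranked_blocks l m k d \<Longrightarrow> C (map (act g \<tau>) (map (act h \<rho>) Ds @ [z])) = j"
      by blast
    have h': "refn ?L ?n l m h \<rho>" using h by (rule refn_weaken) simp_all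
    have main: "C (map (act g \<tau>) (map (act h \<rho>) (Ds @ [v]))) = j"
      if Ds: "Ds \<in> ranked_blocks l m k d" and v: "v \<in> ranked l m k" and bef: "\<forall>E\<in>set Ds. before E v" for Ds v
    proof -
      define Es where "Es = map (act h \<rho>) Ds"
      have Ds_vecs: "set Ds \<subseteq> vecs l m" "v \<in> vecs l m" "length Ds = d"
        using Ds v by (auto simp: ranked_blocks_def ranked_def)
      have Es: "set Es \<subseteq> vecs L' n'" "length Es = d"
        using Ds_vecs act_vecs[OF refn_vecs[OF h]] by (auto simp: Es_def)
      define w where "w = act h \<rho> v"
      have w: "w \<in> ranked ?L ?n k" unfolding w_def by (rule act_ranked[OF h' v k])
      \<comment> \<open>The positions behind all terms but the last: both \<open>w\<close> and
        \<open>z\<close> are supported here.\<close>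
      define U where "U = {t. \<forall>E\<in>set Es. \<forall>s. E s \<noteq> (\<lambda>_. 0) \<longrightarrow> s < t}"
      define P where "P s = map (\<lambda>E. E s) Es" for s
      have D: "D (act_list g \<tau> P) (act g \<tau> u) = C (map (act g \<tau>) (Es @ [u]))" for u
      proof -
        have "map (\<lambda>i s. act_list g \<tau> P s ! i) [0..<d] = map (act g \<tau>) Es"
          using Es(2) by (intro nth_equalityI ext) (auto simp: act_list_def P_def act_def)
        then show ?thesis by (simp add: D_def)
      qed
      have "D (act_list g \<tau> P) (act g \<tau> w) = D (act_list g \<tau> P) (act g \<tau> z)"
      proof (rule inv[OF k _ _ _ w z])
        show "upset U" unfolding upset_def U_def by (auto intro: less_le_trans)
        have zeros: "P s = ?zero" if "\<forall>E\<in>set Es. E s = (\<lambda>_. 0)" for s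
          unfolding P_def using Es(2) that by (intro replicate_eqI) auto
        have "vecs L' n' \<subseteq> vecs ?L ?n" by (rule vecs_mono) simp_all
        then have Es': "E \<in> vecs ?L ?n" if "E \<in> set Es" for E using that Es(1) by blast
        show "P \<in> prefixes d ?L ?n"
          unfolding prefixes_def
        proof (intro CollectI conjI allI impI)
          show "set (P s) \<subseteq> lipc ?L" for s using vecs_lipc[OF Es'] by (auto simp: P_def)
          show "length (P s) = d" for s using Es(2) by (simp add: P_def)
          show "P s = ?zero" if "?n \<le> s" for s
            using Es' that by (intro zeros) (simp add: vecs_def)
        qed
        show "\<forall>s\<in>U. P s = ?zero"
        proof
          fix s assume "s \<in> U"
          then show "P s = ?zero" by (intro zeros) (auto simp: U_def)
        qed
        show "\<forall>s. s \<notin> U \<longrightarrow> w s = (\<lambda>_. 0) \<and> z s = (\<lambda>_. 0)"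
        proof (intro allI impI conjI)
          fix t assume t: "t \<notin> U"
          show "w t = (\<lambda>_. 0)"
          proof (rule ccontr)
            assume wt: "w t \<noteq> (\<lambda>_. 0)"
            have "before E w" if "E \<in> set Es" for E
              using that bef Ds_vecs h before_act[of _ v l m \<rho> h] unfolding Es_def w_def
              by (auto simp: refn_def)
            then show False using t wt by (auto simp: U_def before_def)
          qed
          have "n' \<in> U"
            unfolding U_def
          proof (intro CollectI ballI allI impI)
            fix E s assume E: "E \<in> set Es" "E s \<noteq> (\<lambda>_. 0)"
            then have "E \<in> vecs L' n'" using Es(1) by blast
            then show "s < n'" using E(2) by (cases "s < n'") (simp_all add: vecs_def)
          qed
          then show "z t = (\<lambda>_. 0)" using t by (auto simp: z_def)
        qed
      qed simp
      then show ?thesis using D j[OF Ds] by (simp add: Es_def w_def)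
    qed
    show "\<exists>g \<tau>. refn L n l m g \<tau> \<and> (\<exists>j. \<forall>Ds\<in>ranked_blocks l m k (Suc d). C (map (act g \<tau>) Ds) = j)"
    proof (intro exI[of _ "act g \<tau> h"] exI[of _ "\<rho> \<circ> \<tau>"] exI[of _ j] conjI ballI)
      show "refn L n l m (act g \<tau> h) (\<rho> \<circ> \<tau>)" using g h' by (rule refn_comp)
      fix Ds' assume Ds': "Ds' \<in> ranked_blocks l m k (Suc d)"
      then obtain Ds v where split: "Ds' = Ds @ [v]"
        by (cases Ds' rule: rev_cases) (auto simp: ranked_blocks_def)
      have "C (map (act g \<tau>) (map (act h \<rho>) (Ds @ [v]))) = j"
        by (rule main) (use Ds' in \<open>auto simp: ranked_blocks_def split sorted_wrt_append\<close>)
      then show "C (map (act (act g \<tau> h) (\<rho> \<circ> \<tau>)) Ds') = j"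
        by (simp add: split act_act comp_def)
    qed
  qed
qed

section \<open>Tetris operations\<close>

lemma tetris_lip: "\<exists>f. lip f \<and> (\<forall>p. tetris i p = f \<circ> p)"
proof (cases "i = 0")
  case True
  then show ?thesis by (intro exI[of _ id]) (auto simp: tetris_def lip_def)
next
  case False
  then show ?thesis
    by (intro exI[of _ "\<lambda>y. if y < i then y else y - 1"]) (auto simp: tetris_def lip_def)
qed

lemma foldr_tetris_lip: "\<exists>f. lip f \<and> (\<forall>p. foldr (\<lambda>j. tetris (t j)) js p = f \<circ> p)"
proof (induction js)
  case Nil
  then show ?case by (intro exI[of _ id]) (auto simp: lip_def)
next
  case (Cons a js)
  then obtain f where f: "lip f" "\<forall>p. foldr (\<lambda>j. tetris (t j)) js p = f \<circ> p" by blast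
  obtain f' where f': "lip f'" "\<forall>p. tetris (t a) p = f' \<circ> p" using tetris_lip by blast
  have "foldr (\<lambda>j. tetris (t j)) (a # js) p = (f' \<circ> f) \<circ> p" for p
    using f f' by (simp add: comp_assoc)
  then show ?case using lip_comp[OF f'(1) f(1)] by blast
qed

lemma tetris_comp_lip: "\<exists>f. lip f \<and> (\<forall>p. tetris_comp a b t p = f \<circ> p)"
  unfolding tetris_comp_def by (rule foldr_tetris_lip)

text \<open>Evaluating an operation on a constant function reads off a value of the map that
  represents it. Each factor lowers the constant by one, because its index is positive and at most
  the current height.\<close>

lemma tetris_comp_P_between:
  assumes "i \<in> P_between (Suc k) l" "k \<le> l"
  shows "tetris_comp (Suc k) l i (\<lambda>_. l) = (\<lambda>_. k)"
proof -
  have *: "foldr (\<lambda>j. tetris (i j)) [Suc k..<Suc b] (\<lambda>_. b) = (\<lambda>_. k)" if "k \<le> b" "b \<le> l" for b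
    using that
  proof (induction b rule: dec_induct)
    case (step b)
    have "i (Suc b) \<in> {1..Suc b}" using assms(1) step by (auto simp: P_between_def)
    then have "tetris (i (Suc b)) (\<lambda>_. Suc b) = (\<lambda>_. b)" by (auto simp: tetris_def)
    then show ?case using step by simp
  qed simp
  show ?thesis unfolding tetris_comp_def using *[of l] assms(2) by simp
qed

lemma tetris_comp_zero_vec: "tetris_comp 1 k (zero_vec k) p = p"
proof -
  have *: "foldr (\<lambda>j. tetris (zero_vec k j)) js p = p" if "set js \<subseteq> {1..k}" for js
    using that by (induction js) (auto simp: zero_vec_def tetris_def)
  show ?thesis unfolding tetris_comp_def by (rule *) auto
qed

text \<open>The concrete function of a vector when block \<open>s\<close> is \<open>L\<close> times
  the indicator of \<open>{s + 1}\<close>; the shift keeps 0 out of the support.\<close>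

definition word :: "nat \<Rightarrow> (nat \<Rightarrow> nat \<Rightarrow> nat) \<Rightarrow> nat \<Rightarrow> nat" where
  "word L F x = (if x = 0 then 0 else F (x - 1) L)"

lemma word_Suc [simp]: "word L F (Suc x) = F x L" and word_0 [simp]: "word L F 0 = 0"
  by (simp_all add: word_def)

lemma word_eq_0: "n < x \<Longrightarrow> F \<in> vecs L n \<Longrightarrow> word L F x = 0"
  by (cases x) (auto simp: vecs_def)

lemma word_FIN_upto:
  assumes F: "F \<in> ranked L n k" and k: "1 \<le> k"
  shows "word L F \<in> FIN_upto k n"
proof -
  have Fv: "F \<in> vecs L n" using F by (simp add: ranked_def)
  have sub: "supp (word L F) \<subseteq> {1..n}"
  proof
    fix x assume x: "x \<in> supp (word L F)"
    then have "\<not> n < x" using word_eq_0[OF _ Fv, of x] by (auto simp: supp_def)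
    moreover have "x \<noteq> 0" using x by (cases x) (auto simp: supp_def)
    ultimately show "x \<in> {1..n}" by simp
  qed
  moreover have "finite (supp (word L F))" using sub finite_subset by blast
  moreover have "range (word L F) \<subseteq> {0..k}"
    using F by (auto simp: word_def ranked_def top_on_def)
  moreover obtain s where "F s L = k" using F by (auto simp: ranked_def top_on_def)
  then have "\<exists>x\<ge>1. word L F x = k" by (intro exI[of _ "Suc s"]) simp
  ultimately show ?thesis by (auto simp: FIN_upto_def FIN_def)
qed

text \<open>This inclusion is what transfers homogeneity: a colour constant on all words of rank
  \<open>k\<close> is constant on the span. The rank is \<open>k\<close> because every
  \<open>i s\<close> lowers the top value \<open>l\<close> to \<open>k\<close>, and the zero vector
  preserves \<open>k\<close> at some block.\<close>

lemma tetris_span_word: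
  assumes p: "p \<in> tetris_span k l B" and g: "refn L n l m g \<tau>" and k: "1 \<le> k" "k \<le> l"
    and B: "length B = m" "\<And>t x. t < m \<Longrightarrow> (B ! t) x = (if x \<noteq> 0 \<and> \<tau> (x - 1) = t then g (x - 1) L else 0)"
  shows "\<exists>F\<in>ranked l m k. p = word L (act g \<tau> F)"
proof -
  obtain i t where p_eq: "p = (\<lambda>x. \<Sum>s<length B. tetris_comp 1 k (t s) (tetris_comp (k + 1) l (i s) (B ! s)) x)"
    and i: "\<forall>s<length B. i s \<in> P_between (k + 1) l"
    and t0: "\<exists>s<length B. t s = zero_vec k"
    using p unfolding tetris_span_def by blast
  have "\<exists>f. \<forall>s. lip (f s) \<and> (\<forall>p. tetris_comp 1 k (t s) p = f s \<circ> p)"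
    by (intro choice allI tetris_comp_lip)
  then obtain f where f: "\<And>s. lip (f s)" "\<And>s p. tetris_comp 1 k (t s) p = f s \<circ> p" by blast
  have "\<exists>f. \<forall>s. lip (f s) \<and> (\<forall>p. tetris_comp (k + 1) l (i s) p = f s \<circ> p)"
    by (intro choice allI tetris_comp_lip)
  then obtain f' where f': "\<And>s. lip (f' s)" "\<And>s p. tetris_comp (k + 1) l (i s) p = f' s \<circ> p" by blast
  \<comment> \<open>\<open>min l\<close> freezes the composite above \<open>l\<close>; it changes
    nothing on the blocks, whose values never exceed \<open>l\<close>.\<close>
  define F where "F s = (if s < m then f s \<circ> (f' s \<circ> min l) else (\<lambda>_. 0))" for s
  have f'l: "f' s l = k" if "s < m" for s
  proof -
    have "f' s \<circ> (\<lambda>_. l) = (\<lambda>_::nat. k)"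
      using tetris_comp_P_between[of "i s" k l] f'(2)[of s "\<lambda>_. l"] i that B(1) k by simp
    then show ?thesis by (metis comp_apply)
  qed
  have Fv: "F \<in> vecs l m"
    by (auto simp: vecs_def F_def zero_in_lipc intro!: lipcI lip_comp f f' lip_min)
  obtain s0 where s0: "s0 < m" "t s0 = zero_vec k" using t0 B(1) by blast
  have "f s0 k = k"
  proof -
    have "f s0 \<circ> (\<lambda>_. k) = (\<lambda>_::nat. k)" using f(2)[of s0 "\<lambda>_. k"] s0 tetris_comp_zero_vec by simp
    then show ?thesis by (metis comp_apply)
  qed
  then have "F s0 l = k" using f'l s0 by (simp add: F_def)
  moreover have "F s l \<le> k" for s using f'l lip_le[OF f(1), of s k] by (simp add: F_def)
  ultimately have F: "F \<in> ranked l m k" using Fv by (auto simp: ranked_def top_on_def)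
  have p_sum: "p x = (\<Sum>s<m. f s (f' s ((B ! s) x)))" for x
    by (simp only: p_eq f(2) f'(2) B(1) comp_apply)
  have z: "f s (f' s 0) = 0" for s using f(1)[of s] f'(1)[of s] by (simp add: lip_def)
  have "p x = word L (act g \<tau> F) x" for x
  proof (cases x)
    case 0
    then show ?thesis using z B by (simp add: p_sum)
  next
    case (Suc y)
    have gl: "g y L \<le> l" using g by (simp add: refn_def)
    \<comment> \<open>At position \<open>Suc y\<close> no block except block \<open>\<tau> y\<close>
      can be nonzero, and the maps fix 0.\<close>
    have "p x = (\<Sum>s<m. if s = \<tau> y then F s (g y L) else 0)"
      unfolding p_sum using B(2) Suc z gl by (intro sum.cong) (auto simp: F_def min_def)
    also have "\<dots> = F (\<tau> y) (g y L)" by (simp add: F_def)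
    finally show ?thesis using Suc by (simp add: act_def)
  qed
  then have "p = word L (act g \<tau> F)" by blast
  then show ?thesis using F by blast
qed

text \<open>A nonzero component shows up at a position where its block has full height
  \<open>l\<close>, so the order of supports passes to block indices. Equal indices would give a
  common position that precedes itself.\<close>

lemma word_before:
  assumes g: "refn L n l m g \<tau>" and F: "F \<in> vecs l m" and G: "G \<in> vecs l m"
    and less: "\<And>x y. x \<in> supp (word L (act g \<tau> F)) \<Longrightarrow> y \<in> supp (word L (act g \<tau> G)) \<Longrightarrow> x < y"
  shows "before F G"
proof -
  have point: "\<exists>x. \<tau> x = s \<and> g x L = l \<and> s < m" if "H \<in> vecs l m" "H s \<noteq> (\<lambda>_. 0)" for H s
  proof -
    have "s < m" using that by (cases "s < m") (auto simp: vecs_def)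
    then show ?thesis using g by (auto simp: refn_def)
  qed
  have in_supp: "Suc x \<in> supp (word L (act g \<tau> H))"
    if "H \<in> vecs l m" "H s \<noteq> (\<lambda>_. 0)" "\<tau> x = s" "g x L = l" for H s x
    using that vecs_eq_zero[OF that(1), of s] by (auto simp: supp_def act_def)
  show ?thesis
    unfolding before_def
  proof (intro allI impI)
    fix s t assume st: "F s \<noteq> (\<lambda>_. 0)" "G t \<noteq> (\<lambda>_. 0)"
    obtain x where x: "\<tau> x = s" "g x L = l" using point[OF F st(1)] by blast
    obtain y where y: "\<tau> y = t" "g y L = l" using point[OF G st(2)] by blast
    have "x < y" using less[OF in_supp[OF F st(1) x] in_supp[OF G st(2) y]] by simp
    then have "s \<le> t" using g x y by (auto simp: refn_def mono_def)
    moreover have "s \<noteq> t"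
    proof
      assume "s = t"
      then show False using less[OF in_supp[OF F st(1) x] in_supp[OF G st(2), of x]] x by simp
    qed
    ultimately show "s < t" by simp
  qed
qed

lemma FIN_upto_supp:
  assumes "p \<in> FIN_upto k n" "1 \<le> k"
  shows "finite (supp p)" "supp p \<noteq> {}"
  using assms by (auto simp: FIN_upto_def FIN_def supp_def)

lemma block_sequence_less:
  assumes bs: "block_sequence bs" and fin: "\<And>p. p \<in> set bs \<Longrightarrow> finite (supp p) \<and> supp p \<noteq> {}"
    and ij: "i < j" "j < length bs"
  shows "Max (supp (bs ! i)) < Min (supp (bs ! j))"
  using ij
proof (induction j)
  case (Suc j)
  have step: "Max (supp (bs ! j)) < Min (supp (bs ! Suc j))"
    using bs Suc.prems by (simp add: block_sequence_def)
  show ?case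
  proof (cases "i = j")
    case False
    then have "Max (supp (bs ! i)) < Min (supp (bs ! j))" using Suc by simp
    also have "Min (supp (bs ! j)) \<le> Max (supp (bs ! j))"
      using fin[of "bs ! j"] Suc.prems by (simp add: Min_le)
    finally show ?thesis using step by simp
  qed (use step in simp)
qed simp

theorem theorem2p4:
  fixes k :: nat
  assumes "k \<ge> 1"
  shows "\<forall>d m l r :: nat. d \<ge> 1 \<longrightarrow> m \<ge> d \<longrightarrow> l \<ge> k \<longrightarrow> r \<ge> 1 \<longrightarrow>
    (\<exists>n::nat. n \<ge> 1 \<and>
      (\<forall>c :: (nat \<Rightarrow> nat) list \<Rightarrow> nat.
        c \<in> block_sequences (FIN_upto k n) d \<rightarrow> {1..r} \<longrightarrow>
        (\<exists>B \<in> block_sequences (FIN_upto l n) m.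
          \<exists>j\<in>{1..r}. \<forall>D \<in> block_sequences (tetris_span k l B) d. c D = j)))"
proof (intro allI impI)
  fix d m l r :: nat
  assume "1 \<le> d" "d \<le> m" and kl: "k \<le> l" and r: "1 \<le> r"
  note k = assms
  have l: "1 \<le> l" using k kl by simp
  obtain n L where nL: "\<forall>C. (\<forall>Ds. C Ds < Suc r) \<longrightarrow> (\<exists>g \<tau>. refn L n l m g \<tau> \<and>
     (\<exists>j. \<forall>Ds\<in>ranked_blocks l m k d. C (map (act g \<tau>) Ds) = j))"
    using gowers_blocks[OF k, of "Suc r" l m d] by (elim exE)
  have FIN_Suc: "FIN_upto i n \<subseteq> FIN_upto i (Suc n)" for i by (auto simp: FIN_upto_def)
  show "\<exists>n\<ge>1. \<forall>c. c \<in> block_sequences (FIN_upto k n) d \<rightarrow> {1..r} \<longrightarrow>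
        (\<exists>B \<in> block_sequences (FIN_upto l n) m.
          \<exists>j\<in>{1..r}. \<forall>D \<in> block_sequences (tetris_span k l B) d. c D = j)"
  \<comment> \<open>\<open>Suc n\<close> secures the lower bound 1; a larger range only enlarges the
    sets \<open>FIN_upto\<close>.\<close>
  proof (rule exI[of _ "Suc n"], intro conjI allI impI)
    fix c :: "(nat \<Rightarrow> nat) list \<Rightarrow> nat"
    assume c: "c \<in> block_sequences (FIN_upto k (Suc n)) d \<rightarrow> {1..r}"
    \<comment> \<open>The values of \<open>c\<close> are controlled only on the given block
      sequences. Reducing modulo \<open>Suc r\<close> bounds them everywhere and leaves 1 to
      \<open>r\<close> unchanged.\<close>
    have "\<forall>Ds. c (map (word L) Ds) mod Suc r < Suc r" by simp
    from nL[THEN spec, THEN mp, OF this] obtain g \<tau> j where g: "refn L n l m g \<tau>"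
      and j: "\<forall>Ds\<in>ranked_blocks l m k d. c (map (word L) (map (act g \<tau>) Ds)) mod Suc r = j"
      by (elim exE conjE) (rule that)
    \<comment> \<open>The new block \<open>t\<close> written as a function: the point
      \<open>x\<close> represents the initial block \<open>x - 1\<close>.\<close>
    define b where "b t x = (if x \<noteq> 0 \<and> \<tau> (x - 1) = t then g (x - 1) L else 0)" for t x
    define B where "B = map b [0..<m]"
    have b_FIN: "b t \<in> FIN_upto l n" if t: "t < m" for t
    proof -
      define F where "F s = (if s = t then min l else (\<lambda>_. 0))" for s
      have F: "F \<in> ranked l m l"
        using t by (auto simp: F_def ranked_def vecs_def top_on_def zero_in_lipc min_in_lipc)
      have "b t x = word L (act g \<tau> F) x" for x
      proof (cases x)
        case (Suc y)
        have "g y L \<le> l" using g by (simp add: refn_def)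
        then show ?thesis using Suc by (simp add: b_def F_def act_def min_def)
      qed (simp add: b_def)
      then have "b t = word L (act g \<tau> F)" by blast
      then show ?thesis using word_FIN_upto[OF act_ranked[OF g F l] l] by simp
    qed
    have supp_b: "\<tau> (x - 1) = t" if "x \<in> supp (b t)" for x t
      using that by (simp add: supp_def b_def split: if_splits)
    have "block_sequence B"
      unfolding block_sequence_def
    proof (intro allI impI)
      fix s assume "Suc s < length B"
      then have s: "Suc s < m" by (simp add: B_def)
      have "Max (supp (b s)) \<in> supp (b s)" "Min (supp (b (Suc s))) \<in> supp (b (Suc s))"
        using FIN_upto_supp[OF b_FIN l] s by (simp_all add: Max_in Min_in)
      from supp_b[OF this(1)] supp_b[OF this(2)]
      have "\<tau> (Max (supp (b s)) - 1) < \<tau> (Min (supp (b (Suc s))) - 1)" by simp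
      then have "\<not> Min (supp (b (Suc s))) - 1 \<le> Max (supp (b s)) - 1"
        using g unfolding refn_def mono_def by (meson not_less)
      then show "Max (supp (B ! s)) < Min (supp (B ! Suc s))" using s by (simp add: B_def)
    qed
    moreover have "set B \<subseteq> FIN_upto l (Suc n)" using subsetD[OF FIN_Suc b_FIN] by (auto simp: B_def)
    ultimately have B: "B \<in> block_sequences (FIN_upto l (Suc n)) m"
      by (simp add: block_sequences_def B_def)
    have col: "c D \<in> {1..r} \<and> c D = j" if D: "D \<in> block_sequences (tetris_span k l B) d" for D
    proof -
      have "\<forall>p\<in>tetris_span k l B. \<exists>F\<in>ranked l m k. p = word L (act g \<tau> F)"
        using tetris_span_word[OF _ g k kl, of _ B] by (auto simp: B_def b_def)
      then obtain \<phi> where \<phi>: "\<And>p. p \<in> tetris_span k l B \<Longrightarrow> \<phi> p \<in> ranked l m k"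
        "\<And>p. p \<in> tetris_span k l B \<Longrightarrow> word L (act g \<tau> (\<phi> p)) = p" by metis
      have D': "length D = d" "set D \<subseteq> tetris_span k l B" "block_sequence D"
        using D by (auto simp: block_sequences_def)
      have FIN: "p \<in> FIN_upto k n" if "p \<in> set D" for p
        using word_FIN_upto[OF act_ranked[OF g \<phi>(1) k] k, of p] \<phi>(2)[of p] D'(2) that by auto
      have "sorted_wrt before (map \<phi> D)"
        unfolding sorted_wrt_map sorted_wrt_iff_nth_less[of _ D]
      proof (intro allI impI)
        fix e e' assume e: "e < e'" "e' < length D"
        have mem: "D ! e \<in> tetris_span k l B" "D ! e' \<in> tetris_span k l B" using D'(2) e by auto
        have lt: "Max (supp (D ! e)) < Min (supp (D ! e'))"
          using block_sequence_less[OF D'(3) _ e] FIN_upto_supp[OF FIN k] by blast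
        have "finite (supp (D ! e))" "finite (supp (D ! e'))" using FIN_upto_supp[OF FIN k] e by auto
        then have "x < y" if "x \<in> supp (D ! e)" "y \<in> supp (D ! e')" for x y
          using that lt by (meson Max_ge Min_le le_less_trans less_le_trans)
        then show "before (\<phi> (D ! e)) (\<phi> (D ! e'))"
          using word_before[OF g, of "\<phi> (D ! e)" "\<phi> (D ! e')"] \<phi> mem by (simp add: ranked_def)
      qed
      then have "map \<phi> D \<in> ranked_blocks l m k d" using D' \<phi>(1) by (auto simp: ranked_blocks_def)
      moreover have "map (word L) (map (act g \<tau>) (map \<phi> D)) = D"
        using \<phi>(2) D'(2) by (auto intro!: map_idI)
      ultimately have "c D mod Suc r = j" using j by metis
      moreover have "c D \<in> {1..r}"
      proof -
        have "set D \<subseteq> FIN_upto k (Suc n)" using subsetD[OF FIN_Suc FIN] by blast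
        then have "D \<in> block_sequences (FIN_upto k (Suc n)) d" using D' by (simp add: block_sequences_def)
        then show ?thesis using c by blast
      qed
      ultimately show ?thesis by simp
    qed
    show "\<exists>B \<in> block_sequences (FIN_upto l (Suc n)) m.
        \<exists>j\<in>{1..r}. \<forall>D \<in> block_sequences (tetris_span k l B) d. c D = j"
    \<comment> \<open>Without any sequence to test, every colour serves, and
      \<open>1 \<le> r\<close> provides one. Otherwise \<open>j\<close> is the colour of an actual
      sequence and so lies in \<open>{1..r}\<close>.\<close>
    proof (rule bexI[OF _ B], cases "block_sequences (tetris_span k l B) d = {}")
      case True
      then show "\<exists>j\<in>{1..r}. \<forall>D \<in> block_sequences (tetris_span k l B) d. c D = j" using r by auto
    next
      case False
      then have "j \<in> {1..r}" using col by blast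
      then show "\<exists>j\<in>{1..r}. \<forall>D \<in> block_sequences (tetris_span k l B) d. c D = j" using col by blast
    qed
  qed simp
qed

end
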